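(* Let $n\geq 1$ and let $\lambda=(\lambda_1,\dots,\lambda_\ell)$ be a partition of $n$ with $\ell$ (nonzero) parts. Define $$P_\lambda(q)=\sum_{w} q^{\kappa((1,2,\dots,n)\cdot w)},$$ the sum over all $w\in\mathfrak{S}_n$ of cycle type $\lambda$, and define the polynomial $$g_\lambda(t)=\frac{1}{1-t}\prod_{j=1}^{\ell}(1-t^{\lambda_j}).$$ Then $$P_\lambda(q)=z_\lambda^{-1}\, g_\lambda(E)\,(q+n-1)_n,$$ where $E$ is the backward shift operator on polynomials in $q$, $Ef(q)=f(q-1)$, and $(a)_n=a(a-1)\cdots(a-n+1)$ denotes the falling factorial.
   Context: $\mathfrak{S}_n$ is the symmetric group on $\{1,\dots,n\}$; the cycle type of $w$ is the partition of $n$ formed by the lengths of its cycles. $\kappa(v)$ denotes the number of cycles of a permutation $v$ (fixed points counted as cycles). $(1,2,\dots,n)$ denotes the $n$-cycle $1\to2\to\cdots\to n\to 1$. For a partition $\lambda$ of $n$ having $m_i$ parts equal to $i$, $z_\lambda=\prod_i i^{m_i}m_i!$, so that the number of permutations in $\mathfrak{S}_n$ of cycle type $\lambda$ is $n!/z_\lambda$. *)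

theory Defs
  imports
    "HOL-Library.Multiset"
    "HOL-Combinatorics.Cycles"
    "HOL-Combinatorics.Orbits"
    "HOL-Computational_Algebra.Polynomial"
begin

section \<open>Partitions and permutations\<close>

text \<open>
  The symmetric group on \<open>{1, ..., n}\<close> is \<open>{w. w permutes {1..n}}\<close>.
  A partition of \<open>n\<close> is represented by the multiset of its parts.
\<close>

definition partition_of :: "nat multiset \<Rightarrow> nat \<Rightarrow> bool" where
  "partition_of lam n \<longleftrightarrow> 0 \<notin># lam \<and> sum_mset lam = n"

definition z_partition :: "nat multiset \<Rightarrow> nat" where
  "z_partition lam = (\<Prod>i\<in>set_mset lam. i ^ count lam i * fact (count lam i))"

text \<open>A cycle is identified with its underlying set of points; fixed points give singletons.\<close>

definition perm_cycles :: "nat \<Rightarrow> (nat \<Rightarrow> nat) \<Rightarrow> nat set set" where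
  "perm_cycles n w = orbit w ` {1..n}"

definition num_cycles :: "nat \<Rightarrow> (nat \<Rightarrow> nat) \<Rightarrow> nat" where
  "num_cycles n w = card (perm_cycles n w)"

definition cycle_type :: "nat \<Rightarrow> (nat \<Rightarrow> nat) \<Rightarrow> nat multiset" where
  "cycle_type n w = image_mset card (mset_set (perm_cycles n w))"

definition long_cycle :: "nat \<Rightarrow> nat \<Rightarrow> nat" where
  "long_cycle n = cycle_of_list [1..<Suc n]"

lemma long_cycle_eq:
  assumes "i \<in> {1..n}"
  shows "long_cycle n i = (if i = n then 1 else i + 1)"
proof -
  let ?cs = "[1..<Suc n]"
  have "map (long_cycle n) ?cs = rotate1 ?cs"
    using cyclic_rotation[of ?cs 1] by (simp add: long_cycle_def)
  then have "map (long_cycle n) ?cs ! (i - 1) = rotate1 ?cs ! (i - 1)"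
    by (rule arg_cong)
  with assms show ?thesis
    by (cases "i = n") (auto simp: nth_rotate1 simp del: upt_Suc)
qed

lemma long_cycle_permutes: "long_cycle n permutes {1..n}"
  using cycle_permutes[of "[1..<Suc n]"]
  by (simp add: long_cycle_def atLeastLessThanSuc_atLeastAtMost del: upt_Suc)


section \<open>Polynomials\<close>

definition cycle_poly :: "nat \<Rightarrow> nat multiset \<Rightarrow> 'a::comm_ring_1 poly" where
  "cycle_poly n lam =
     (\<Sum>w | w permutes {1..n} \<and> cycle_type n w = lam. monom 1 (num_cycles n (long_cycle n \<circ> w)))"

definition g_poly :: "nat multiset \<Rightarrow> 'a::field poly" where
  "g_poly lam = (\<Prod>k\<in>#lam. 1 - monom 1 k) div (1 - monom 1 1)"

text \<open>The division is exact for a nonempty partition.\<close>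

lemma g_poly_exact:
  assumes "lam \<noteq> {#}"
  shows "(1 - monom 1 1) * g_poly lam = (\<Prod>k\<in>#lam. 1 - monom 1 k :: 'a::field poly)"
proof -
  obtain k where k: "k \<in># lam"
    using assms by blast
  have "1 - monom 1 1 dvd (1 - monom 1 k :: 'a poly)"
    by (simp add: dvd_iff_poly_eq_0 monom_altdef one_diff_power_eq)
  also have "\<dots> dvd (\<Prod>k\<in>#lam. 1 - monom 1 k)"
    using k by (intro dvd_prod_mset) auto
  finally show ?thesis
    by (simp add: g_poly_def)
qed

definition backward_shift :: "'a::comm_ring_1 poly \<Rightarrow> 'a poly" where
  "backward_shift f = pcompose f [:-1, 1:]"

lemma poly_backward_shift: "poly (backward_shift f) x = poly f (x - 1)"
  by (simp add: backward_shift_def poly_pcompose)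

text \<open>\<open>poly_op g T\<close> is the operator \<open>g(T)\<close>, for \<open>T\<close> an operator on polynomials.\<close>

definition poly_op :: "'a::comm_ring_1 poly \<Rightarrow> ('a poly \<Rightarrow> 'a poly) \<Rightarrow> 'a poly \<Rightarrow> 'a poly" where
  "poly_op g T f = (\<Sum>i\<le>degree g. smult (coeff g i) ((T ^^ i) f))"

definition falling_factorial :: "'a::comm_ring_1 \<Rightarrow> nat \<Rightarrow> 'a" where
  "falling_factorial a n = (\<Prod>i<n. a - of_nat i)"

end

theory Submission
  imports Defs
begin

text \<open>
  All \<open>n\<close>-cycles are conjugate and there are \<open>n!/z_lam\<close> permutations of type \<open>lam\<close>, so one may fix \<open>w\<close> of
  type \<open>lam\<close> and sum \<open>q^kappa(u w)\<close> over all \<open>n\<close>-cycles \<open>u\<close> instead. For every permutation \<open>u\<close>, the sum of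
  \<open>(-1)^k t^|S|\<close> over the \<open>u\<close>-stable sets \<open>S\<close>, where \<open>k\<close> is the number of cycles of \<open>u\<close> in \<open>S\<close>, is the
  product of \<open>1 - t^|C|\<close> over the cycles \<open>C\<close> of \<open>u\<close>. Its derivative at \<open>t = 1\<close> is \<open>-n\<close> if \<open>u\<close> is an
  \<open>n\<close>-cycle and \<open>0\<close> otherwise, which turns the sum over \<open>n\<close>-cycles into a signed sum over pairs of a
  set \<open>S\<close> and a permutation \<open>u\<close> stabilizing it. For fixed \<open>S\<close>, the inner sum vanishes by a
  sign-reversing involution unless \<open>w\<close> moves at most one point out of \<open>S\<close>, and is then, up to sign and
  a factor \<open>q\<close>, a rising factorial shifted by \<open>|S|\<close>. The sets \<open>S\<close> stable under \<open>w\<close>, and those stable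
  under \<open>(c b) w\<close> for a transposition separating \<open>c \<in> S\<close> from \<open>b \<notin> S\<close>, have generating functions that
  are expressed through \<open>g_lam\<close> and its derivative.
\<close>

subsection \<open>Cycles of a permutation times a transposition\<close>

abbreviation cycles_on :: "('a \<Rightarrow> 'a) \<Rightarrow> 'a set \<Rightarrow> 'a set set" where
  "cycles_on p A \<equiv> orbit p ` A"

text \<open>\<open>orbit\<close> collects the points reached in at least one step, so a point lies
  in its own orbit only because iterating a permutation of a finite set returns to it.\<close>

lemma permutes_self_in_orbit:
  assumes "p permutes A" "finite A"
  shows "x \<in> orbit p x"
  by (rule permutation_self_in_orbit) (rule permutes_imp_permutation[OF assms(2,1)])

lemma permutes_orbit_eq:
  assumes "p permutes A" "finite A" "y \<in> orbit p x"
  shows "orbit p y = orbit p x"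
  using assms cyclic_on_orbit orbit_cyclic_eq3 by metis

lemma permutes_orbit_eq_iff:
  assumes "p permutes A" "finite A"
  shows "orbit p x = orbit p y \<longleftrightarrow> x \<in> orbit p y"
  using assms permutes_orbit_eq permutes_self_in_orbit by metis

lemma orbit_subset_stable:
  assumes "x \<in> S" "p ` S \<subseteq> S"
  shows "orbit p x \<subseteq> S"
proof
  fix y assume "y \<in> orbit p x"
  then show "y \<in> S" by induction (use assms in auto)
qed

lemma Union_cycles_on:
  assumes "p permutes A" "finite A" "S \<subseteq> A" "p ` S = S"
  shows "\<Union>(cycles_on p S) = S"
  using permutes_self_in_orbit[OF assms(1,2)] orbit_subset_stable[of _ S p] assms(4) by blast

lemma disjoint_cycles_on:
  assumes "p permutes A" "finite A"
  shows "disjoint (cycles_on p S)"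
  unfolding disjoint_def by (auto dest: permutes_orbit_eq[OF assms])

lemma cycles_on_subset:
  assumes "p permutes A" "C \<in> cycles_on p A"
  shows "C \<subseteq> A"
  using assms permutes_orbit_subset by fastforce

lemma sum_card_cycles_on:
  assumes "p permutes A" "finite A" "D \<subseteq> cycles_on p A"
  shows "card (\<Union>D) = (\<Sum>C\<in>D. card C)"
proof (rule card_Union_disjoint)
  show "disjoint D" using disjoint_cycles_on[OF assms(1,2)] assms(3) by (meson pairwise_subset)
  show "\<And>C. C \<in> D \<Longrightarrow> finite C" 
    using assms cycles_on_subset finite_subset by (metis subsetD)
qed

section \<open>Merging two cycles by a transposition\<close>

lemma orbit_comp_transpose_merge:
  assumes "p permutes A" "finite A" "orbit p a \<noteq> orbit p b"
  shows "orbit (p \<circ> transpose a b) a = orbit p a \<union> orbit p b"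
proof -
  note self = permutes_self_in_orbit[OF assms(1,2)]
  note eqI = permutes_orbit_eq[OF assms(1,2)]
  let ?p = "p \<circ> transpose a b"
  \<comment> \<open>From \<open>c\<close> the product jumps to \<open>p d\<close> and then follows
    the cycle of \<open>d\<close> as \<open>p\<close> does; the case \<open>y = d\<close> closes
    because \<open>p d\<close> is already the image of \<open>c\<close>.\<close>
  have sub: "orbit p d \<subseteq> orbit (p \<circ> transpose c d) c" if ne: "orbit p c \<noteq> orbit p d" for c d
  proof
    fix y assume "y \<in> orbit p d"
    then show "y \<in> orbit (p \<circ> transpose c d) c"
    proof induction
      case base
      have "(p \<circ> transpose c d) c = p d" by simp
      then show ?case by (metis orbit.base)
    next
      case (step y)
      have "y \<noteq> c" using step(1) ne eqI by blast
      show ?case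
      proof (cases "y = d")
        case True
        have "(p \<circ> transpose c d) c = p d" by simp
        then show ?thesis using True by (metis orbit.base)
      next
        case False
        then have "(p \<circ> transpose c d) y = p y" using \<open>y \<noteq> c\<close> by (simp add: transpose_def)
        then show ?thesis using step(2) by (metis orbit.step)
      qed
    qed
  qed
  have b: "orbit p b \<subseteq> orbit ?p a" using sub assms(3) by blast
  have "orbit p a \<subseteq> orbit ?p b" using sub[of b a] assms(3) by (metis transpose_commute)
  also have "orbit ?p b \<subseteq> orbit ?p a" using b self orbit_trans by fastforce
  finally have 1: "orbit p a \<union> orbit p b \<subseteq> orbit ?p a" using b by blast
  have 2: "orbit ?p a \<subseteq> orbit p a \<union> orbit p b"
  proof (rule orbit_subset_stable)
    have "p y \<in> orbit p a \<union> orbit p b \<and> p a \<in> orbit p a \<and> p b \<in> orbit p b"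
      if "y \<in> orbit p a \<union> orbit p b" for y
      using that by (auto intro: orbit.base orbit.step)
    then show "?p ` (orbit p a \<union> orbit p b) \<subseteq> orbit p a \<union> orbit p b"
      by (fastforce simp: transpose_def)
  qed (use self in auto)
  from 1 2 show ?thesis by blast
qed

lemma orbit_comp_transpose_other:
  assumes "p permutes A" "finite A" "x \<notin> orbit p a" "x \<notin> orbit p b"
  shows "orbit (p \<circ> transpose a b) x = orbit p x"
proof (rule orbit_cong)
  show "x \<in> orbit p x" using permutes_self_in_orbit[OF assms(1,2)] .
  fix s assume "s \<in> orbit p x"
  then have "s \<noteq> a" "s \<noteq> b" 
    using assms permutes_orbit_eq_iff[OF assms(1,2)] permutes_orbit_eq[OF assms(1,2)] by blast+
  then show "(p \<circ> transpose a b) s = p s" by (simp add: transpose_def)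
qed

lemma cycles_on_comp_transpose_merge:
  assumes "p permutes A" "finite A" "a \<in> A" "b \<in> A" "orbit p a \<noteq> orbit p b"
  shows "cycles_on (p \<circ> transpose a b) A =
    insert (orbit p a \<union> orbit p b) (cycles_on p A - {orbit p a, orbit p b})" (is "?L = ?R")
proof -
  let ?p = "p \<circ> transpose a b"
  have p': "?p permutes A" using assms by (simp add: permutes_compose permutes_swap_id)
  note self = permutes_self_in_orbit[OF assms(1,2)]
  note iff = permutes_orbit_eq_iff[OF assms(1,2)]
  have ab: "orbit ?p a = orbit p a \<union> orbit p b"
    by (rule orbit_comp_transpose_merge[OF assms(1,2,5)])
  have *: "orbit ?p x = (if x \<in> orbit p a \<union> orbit p b then orbit p a \<union> orbit p b else orbit p x)" for x
    using ab orbit_comp_transpose_other[OF assms(1,2)] permutes_orbit_eq[OF p' assms(2), of x a] by auto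
  show ?thesis
  proof (intro set_eqI iffI)
    fix C assume "C \<in> ?L"
    then obtain x where x: "x \<in> A" "C = orbit ?p x" by auto
    then show "C \<in> ?R" using * iff by auto
  next
    fix C assume "C \<in> ?R"
    then consider "C = orbit p a \<union> orbit p b" | x where "x \<in> A" "C = orbit p x" "C \<noteq> orbit p a" "C \<noteq> orbit p b"
      by auto
    then show "C \<in> ?L"
    proof cases
      case 1 then show ?thesis using ab assms(3) by auto
    next
      case 2
      then have "orbit ?p x = C" using * iff by auto
      then show ?thesis using 2 by auto
    qed
  qed
qed

lemma orbit_inv:
  assumes "p permutes A" "finite A"
  shows "orbit (inv p) = orbit p"
  using orbit_inv_eq[OF permutes_imp_permutation[OF assms(2,1)]] by blast

text \<open>Orbits do not change under inversion, and inversion turns a left factor into a right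
  one, so the merging results carry over to left multiplication.\<close>

lemma transpose_comp_orbit:
  assumes "p permutes A" "finite A" "a \<in> A" "b \<in> A"
  shows "orbit (transpose a b \<circ> p) = orbit (inv p \<circ> transpose a b)"
proof -
  have "transpose a b \<circ> p permutes A" using assms by (simp add: permutes_compose permutes_swap_id)
  then have "orbit (transpose a b \<circ> p) = orbit (inv (transpose a b \<circ> p))"
    using orbit_inv assms(2) by metis
  also have "inv (transpose a b \<circ> p) = inv p \<circ> inv (transpose a b)"
    using assms(1) by (intro o_inv_distrib) (auto simp: permutes_bij)
  also have "inv (transpose a b) = transpose a b" by simp
  finally show ?thesis .
qed

lemma cycles_on_transpose_comp_merge:
  assumes "p permutes A" "finite A" "a \<in> A" "b \<in> A" "orbit p a \<noteq> orbit p b"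
  shows "cycles_on (transpose a b \<circ> p) A =
    insert (orbit p a \<union> orbit p b) (cycles_on p A - {orbit p a, orbit p b})"
  using cycles_on_comp_transpose_merge[of "inv p" A a b] assms
  by (simp add: transpose_comp_orbit orbit_inv[OF assms(1,2)] permutes_inv)

lemma orbit_transpose_comp_merge:
  assumes "p permutes A" "finite A" "a \<in> A" "b \<in> A" "orbit p a \<noteq> orbit p b"
  shows "orbit (transpose a b \<circ> p) a = orbit p a \<union> orbit p b"
  using orbit_comp_transpose_merge[of "inv p" A a b] assms
  by (simp add: transpose_comp_orbit orbit_inv[OF assms(1,2)] permutes_inv)

section \<open>Cycles under conjugation\<close>

lemma orbit_conj:
  assumes "p permutes A" "finite A" "s permutes A"
  shows "orbit (s \<circ> p \<circ> inv s) (s x) = s ` orbit p x"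
  by (rule orbit_inverse[symmetric])
     (use assms in \<open>auto simp: permutes_self_in_orbit permutes_inverses\<close>)

lemma cycles_on_conj:
  assumes "p permutes A" "finite A" "s permutes A"
  shows "cycles_on (s \<circ> p \<circ> inv s) A = image s ` cycles_on p A"
proof -
  have "cycles_on (s \<circ> p \<circ> inv s) A = orbit (s \<circ> p \<circ> inv s) ` s ` A"
    using permutes_image[OF assms(3)] by simp
  also have "\<dots> = image s ` cycles_on p A"
    unfolding image_image orbit_conj[OF assms] ..
  finally show ?thesis .
qed

lemma card_cycles_on_conj:
  assumes "p permutes A" "finite A" "s permutes A"
  shows "card (cycles_on (s \<circ> p \<circ> inv s) A) = card (cycles_on p A)"
  unfolding cycles_on_conj[OF assms]
  by (rule card_image) (meson assms(3) inj_image_eq_iff inj_onI permutes_inj)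

text \<open>The two products are conjugate by \<open>r\<close>.\<close>

lemma card_cycles_on_comp_commute:
  assumes "p permutes A" "r permutes A" "finite A"
  shows "card (cycles_on (p \<circ> r) A) = card (cycles_on (r \<circ> p) A)"
proof -
  have "r \<circ> (p \<circ> r) \<circ> inv r = r \<circ> p"
    using assms by (auto simp: fun_eq_iff permutes_inverses)
  then show ?thesis
    using card_cycles_on_conj[of "p \<circ> r" A r] assms by (simp add: permutes_compose)
qed

lemma card_cycles_on_merge:
  assumes "p permutes A" "finite A" "a \<in> A" "b \<in> A" "orbit p a \<noteq> orbit p b"
  shows "Suc (card (cycles_on (transpose a b \<circ> p) A)) = card (cycles_on p A)"
proof -
  let ?X = "cycles_on p A"
  have "orbit p a \<union> orbit p b \<notin> ?X - {orbit p a, orbit p b}"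
  proof
    assume "orbit p a \<union> orbit p b \<in> ?X - {orbit p a, orbit p b}"
    then obtain x where "orbit p a \<union> orbit p b = orbit p x" by auto
    then have "a \<in> orbit p x" "b \<in> orbit p x"
      using permutes_self_in_orbit[OF assms(1,2)] by blast+
    then show False using permutes_orbit_eq[OF assms(1,2)] assms(5) by metis
  qed
  then have "card (cycles_on (transpose a b \<circ> p) A) = Suc (card (?X - {orbit p a, orbit p b}))"
    unfolding cycles_on_transpose_comp_merge[OF assms] using assms(2) by simp
  moreover have "card ?X \<ge> card {orbit p a, orbit p b}"
    using assms by (intro card_mono) auto
  ultimately show ?thesis using assms by (simp add: card_Diff_subset)
qed

section \<open>Splitting a cycle by a transposition\<close>

text \<open>The product agrees with \<open>p\<close> along the first \<open>d - 1\<close> steps from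
  \<open>c\<close>; the next step would reach \<open>b\<close> and is redirected to
  \<open>c\<close>. So the cycle of \<open>c\<close> closes after \<open>d\<close> steps and leaves
  \<open>b\<close> outside.\<close>

lemma orbit_transpose_comp_split:
  assumes p: "p permutes A" "finite A" and c: "c \<in> A" and d: "0 < d" "d < card (orbit p c)"
  defines "b \<equiv> (p ^^ d) c"
  shows "orbit (transpose c b \<circ> p) c = (\<lambda>i. (p ^^ i) c) ` {..<d}"
    and "card (orbit (transpose c b \<circ> p) c) = d"
    and "b \<notin> orbit (transpose c b \<circ> p) c"
    and "c \<noteq> b"
proof -
  let ?r = "transpose c b \<circ> p"
  \<comment> \<open>First return time of \<open>c\<close>, which is the length of its cycle.\<close>
  let ?N = "funpow_dist1 p c c"
  have self: "c \<in> orbit p c" by (rule permutes_self_in_orbit[OF p])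
  have inj: "inj_on (\<lambda>n. (p ^^ n) c) {0..<?N}" by (rule inj_on_funpow_dist1[OF self])
  have N: "card (orbit p c) = ?N"
    using card_image[OF inj] orbit_conv_funpow_dist1[OF self] by simp
  have ne: "(p ^^ i) c \<noteq> (p ^^ j) c" if "i \<noteq> j" "i < ?N" "j < ?N" for i j
    using inj that unfolding inj_on_def by auto
  show cb: "c \<noteq> b" using ne[of 0 d] d N b_def by simp
  have pow: "(?r ^^ i) c = (p ^^ i) c" if "i < d" for i
    using that
  proof (induction i)
    case (Suc i)
    have "(p ^^ Suc i) c \<noteq> c" "(p ^^ Suc i) c \<noteq> b"
      using ne[of "Suc i" 0] ne[of "Suc i" d] Suc d N b_def by (simp_all del: funpow.simps add: funpow_0)
    then show ?case using Suc by (simp add: transpose_def)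
  qed simp
  have rd: "(?r ^^ d) c = c"
  proof -
    obtain e where e: "d = Suc e" using d(1) by (cases d) auto
    show ?thesis using pow[of e] e by (simp add: b_def)
  qed
  have "orbit ?r c = {(?r ^^ m) c |m. m < d}" by (rule orbit_altdef_bounded[OF rd d(1)])
  also have "\<dots> = (\<lambda>i. (?r ^^ i) c) ` {..<d}" by auto
  also have "\<dots> = (\<lambda>i. (p ^^ i) c) ` {..<d}" using pow by (intro image_cong) auto
  finally show orb: "orbit ?r c = (\<lambda>i. (p ^^ i) c) ` {..<d}" .
  show "card (orbit ?r c) = d" unfolding orb
    by (subst card_image) (use inj d N in \<open>auto intro: inj_on_subset\<close>)
  have "(p ^^ d) c \<noteq> (p ^^ i) c" if "i < d" for i using ne[of d i] that d N by simp
  then show "b \<notin> orbit ?r c" unfolding orb by (auto simp: b_def)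
qed

lemma orbit_power_obtain:
  assumes p: "p permutes A" "finite A" and "c \<in> A" "b \<in> orbit p c" "b \<noteq> c"
  obtains d where "0 < d" "d < card (orbit p c)" "b = (p ^^ d) c"
proof -
  have self: "c \<in> orbit p c" by (rule permutes_self_in_orbit[OF p])
  have inj: "inj_on (\<lambda>n. (p ^^ n) c) {0..<funpow_dist1 p c c}" by (rule inj_on_funpow_dist1[OF self])
  have o: "orbit p c = (\<lambda>n. (p ^^ n) c) ` {0..<funpow_dist1 p c c}"
    by (rule orbit_conv_funpow_dist1[OF self])
  obtain d where d: "d < card (orbit p c)" "b = (p ^^ d) c"
    using assms(4) card_image[OF inj] o by auto
  with assms(5) have "0 < d" by (cases d) auto
  with d that show thesis by blast
qed

lemma orbit_transpose_comp_neq: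
  assumes "p permutes A" "finite A" "c \<in> A" "b \<in> orbit p c" "b \<noteq> c"
  shows "orbit (transpose c b \<circ> p) c \<noteq> orbit (transpose c b \<circ> p) b"
proof -
  from assms obtain d where d: "0 < d" "d < card (orbit p c)" "b = (p ^^ d) c"
    using orbit_power_obtain[OF assms] by blast
  have b: "b \<in> A" using assms(4) permutes_orbit_subset[OF assms(1,3)] by blast
  have r: "transpose c b \<circ> p permutes A" using assms b by (simp add: permutes_compose permutes_swap_id)
  show ?thesis
    using orbit_transpose_comp_split(3)[OF assms(1-3) d(1,2)] d(3) permutes_self_in_orbit[OF r assms(2)]
    by metis
qed

section \<open>Parity of the number of cycles, and the sign\<close>

lemma even_card_cycles_on_transpose:
  assumes "p permutes A" "finite A" "a \<in> A" "b \<in> A" "a \<noteq> b"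
  shows "even (card (cycles_on (transpose a b \<circ> p) A)) \<longleftrightarrow> odd (card (cycles_on p A))"
proof (cases "orbit p a = orbit p b")
  case False
  then show ?thesis using card_cycles_on_merge[OF assms(1-4)] by (metis even_Suc)
next
  case True
  then have "b \<in> orbit p a" using permutes_self_in_orbit[OF assms(1,2)] by metis
  \<comment> \<open>Here the product has separated \<open>a\<close> from \<open>b\<close>, so the
    merging count is applied to the product; multiplying by the transposition once more gives back
    \<open>p\<close>.\<close>
  then have ne: "orbit (transpose a b \<circ> p) a \<noteq> orbit (transpose a b \<circ> p) b"
    using assms by (intro orbit_transpose_comp_neq) auto
  have r: "transpose a b \<circ> p permutes A" using assms by (simp add: permutes_compose permutes_swap_id)
  have "transpose a b \<circ> (transpose a b \<circ> p) = p" by (simp add: fun_eq_iff)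
  then show ?thesis using card_cycles_on_merge[OF r assms(2-4) ne] by (metis even_Suc)
qed

text \<open>The identity has \<open>card A\<close> cycles, and each transposition reverses both the
  sign and the parity of the number of cycles.\<close>

lemma sign_eq_cycles_on:
  assumes "p permutes A" "finite A"
  shows "(-1) ^ card (cycles_on p A) = (-1) ^ card A * (of_int (sign p) :: 'b::comm_ring_1)"
  using assms
proof (induction rule: permutes_induct)
  case id
  have "orbit id x = {x}" for x :: 'a using orbit_eq_singleton_iff[of id x] by simp
  then have "cycles_on id A = (\<lambda>x. {x}) ` A" by auto
  then have "card (cycles_on id A) = card A" by (simp add: card_image)
  then show ?case by (simp add: id_def[symmetric] del: id_apply)
next
  case (swap a b p)
  have "(-1 :: 'b) ^ card (cycles_on (transpose a b \<circ> p) A) = - ((-1) ^ card (cycles_on p A))"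
    using even_card_cycles_on_transpose[OF \<open>p permutes A\<close> assms(2) \<open>a \<in> A\<close> \<open>b \<in> A\<close> \<open>a \<noteq> b\<close>]
    unfolding minus_one_power_iff by simp
  moreover have "sign (transpose a b \<circ> p) = - sign p"
    using swap assms(2) by (subst sign_compose) (auto simp: permutation_swap_id sign_swap_id permutes_imp_permutation)
  ultimately show ?case by (simp only: swap.IH of_int_minus mult_minus_right)
qed

subsection \<open>Sums over set stabilizers\<close>

lemma cycles_on_insert_fixed:
  assumes "p permutes F" "x \<notin> F"
  shows "cycles_on p (insert x F) = insert {x} (cycles_on p F)" and "{x} \<notin> cycles_on p F"
proof -
  have "orbit p x = {x}"
    using permutes_not_in[OF assms] by (simp add: orbit_eq_singleton_iff)
  then show "cycles_on p (insert x F) = insert {x} (cycles_on p F)" by simp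
  show "{x} \<notin> cycles_on p F" using cycles_on_subset[OF assms(1)] assms(2) by blast
qed

text \<open>The point \<open>x\<close> is fixed by \<open>p\<close>, so the transposition merges its
  singleton with the cycle of \<open>b\<close>.\<close>

lemma cycles_on_insert_transpose:
  assumes "p permutes F" "finite F" "x \<notin> F" "b \<in> F"
  shows "cycles_on (transpose x b \<circ> p) (insert x F) =
    insert (insert x (orbit p b)) (cycles_on p F - {orbit p b})"
proof -
  have p: "p permutes insert x F" using assms(1) by (rule permutes_subset) auto
  have x: "orbit p x = {x}"
    using permutes_not_in[OF assms(1,3)] by (simp add: orbit_eq_singleton_iff)
  have "orbit p b \<subseteq> F" using assms by (intro permutes_orbit_subset)
  then have "orbit p x \<noteq> orbit p b" using x assms(3) by auto
  from cycles_on_transpose_comp_merge[OF p _ _ _ this] show ?thesis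
    using assms cycles_on_insert_fixed[OF assms(1,3)] x by auto
qed

lemma insert_orbit_notin_cycles_on:
  assumes "p permutes F" "x \<notin> F"
  shows "insert x C \<notin> cycles_on p F"
  using cycles_on_subset[OF assms(1)] assms(2) by blast

text \<open>Generating function of the Stirling numbers of the first kind: a new point forms its own
  cycle, with weight \<open>q\<close>, or joins an existing cycle in \<open>card F\<close> ways,
  which multiplies the sum by \<open>q + card F\<close>.\<close>

lemma sum_power_cycles_on:
  fixes q :: "'b::comm_ring_1"
  assumes "finite A"
  shows "(\<Sum>p | p permutes A. q ^ card (cycles_on p A)) = pochhammer q (card A)"
  using assms
proof (induction A rule: finite_induct)
  case empty
  have "{p. p permutes ({} :: 'a set)} = {id}" by auto
  then show ?case by simp
next
  case (insert x F)
  have 1: "q ^ card (cycles_on (transpose x b \<circ> p) (insert x F)) =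
    (if b = x then q else 1) * q ^ card (cycles_on p F)" if "b \<in> insert x F" "p permutes F" for b p
  proof (cases "b = x")
    case True
    have "card (cycles_on p (insert x F)) = Suc (card (cycles_on p F))"
      using cycles_on_insert_fixed[OF that(2) insert.hyps(2)] insert.hyps(1) by simp
    then show ?thesis using True by simp
  next
    case False
    then have b: "b \<in> F" using that by simp
    have "card (cycles_on (transpose x b \<circ> p) (insert x F)) = Suc (card (cycles_on p F - {orbit p b}))"
      using cycles_on_insert_transpose[OF that(2) insert.hyps b] insert.hyps(1)
        insert_orbit_notin_cycles_on[OF that(2) insert.hyps(2)] by simp
    also have "\<dots> = card (cycles_on p F)"
      by (rule card_Suc_Diff1) (use b insert.hyps in auto)
    finally show ?thesis using False by simp
  qed
  have "(\<Sum>p | p permutes insert x F. q ^ card (cycles_on p (insert x F))) =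
    (\<Sum>b\<in>insert x F. \<Sum>p | p permutes F. (if b = x then q else 1) * q ^ card (cycles_on p F))"
    unfolding sum_over_permutations_insert[OF insert.hyps] by (intro sum.cong refl) (use 1 in auto)
  also have "\<dots> = (\<Sum>b\<in>insert x F. (if b = x then q else 1) * pochhammer q (card F))"
    by (simp only: sum_distrib_left[symmetric] insert.IH)
  also have "\<dots> = q * pochhammer q (card F) + (\<Sum>b\<in>F. (if b = x then q else 1) * pochhammer q (card F))"
    using insert.hyps by simp
  also have "(\<Sum>b\<in>F. (if b = x then q else 1) * pochhammer q (card F)) = (\<Sum>b\<in>F. pochhammer q (card F))"
    by (rule sum.cong) (use insert.hyps in auto)
  finally show ?case using insert.hyps by (simp add: pochhammer_Suc algebra_simps)
qed

section \<open>The stabilizer of a set\<close>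

text \<open>For \<open>S \<subseteq> A\<close> this is a Young subgroup, the product of the
  symmetric groups on \<open>S\<close> and on \<open>A - S\<close>.\<close>

definition set_stabilizer :: "'a set \<Rightarrow> 'a set \<Rightarrow> ('a \<Rightarrow> 'a) set" where
  "set_stabilizer A S = {u. u permutes A \<and> u ` S = S}"

context
  fixes A S :: "'a set"
  assumes fin: "finite A" and sub: "S \<subseteq> A"
begin

lemma set_stabilizer_comp:
  assumes "u \<in> set_stabilizer A S" "v \<in> set_stabilizer A S"
  shows "u \<circ> v \<in> set_stabilizer A S"
proof -
  have "(u \<circ> v) ` S = u ` v ` S" by (rule image_comp[symmetric])
  then show ?thesis using assms by (simp add: set_stabilizer_def permutes_compose)
qed

lemma set_stabilizer_inv:
  assumes "u \<in> set_stabilizer A S"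
  shows "inv u \<in> set_stabilizer A S"
proof -
  have u: "u permutes A" "u ` S = S" using assms by (auto simp: set_stabilizer_def)
  have "inv u ` S = inv u ` u ` S" using u by simp
  also have "\<dots> = S" unfolding image_comp using u by (simp add: permutes_inv_o)
  finally show ?thesis using u by (auto simp: set_stabilizer_def permutes_inv)
qed

lemma set_stabilizer_bij:
  assumes "u \<in> set_stabilizer A S"
  shows "bij_betw u S S"
  using assms unfolding set_stabilizer_def bij_betw_def by (auto intro: permutes_inj_on)

lemma set_stabilizer_Compl:
  assumes "u \<in> set_stabilizer A S"
  shows "u ` (A - S) = A - S"
proof -
  have u: "u permutes A" "u ` S = S" using assms by (auto simp: set_stabilizer_def)
  have "u ` (A - S) = u ` A - u ` S" by (rule image_set_diff) (rule permutes_inj[OF u(1)])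
  then show ?thesis using u permutes_image by metis
qed

lemma sum_set_stabilizer_left:
  assumes "v \<in> set_stabilizer A S"
  shows "(\<Sum>u\<in>set_stabilizer A S. f (v \<circ> u)) = (\<Sum>u\<in>set_stabilizer A S. f u)"
  by (rule sum.reindex_bij_witness[of _ "\<lambda>u. inv v \<circ> u" "\<lambda>u. v \<circ> u"])
     (use assms set_stabilizer_comp set_stabilizer_inv in \<open>auto simp: set_stabilizer_def o_assoc permutes_inv_o\<close>)

lemma sum_set_stabilizer_right:
  assumes "v \<in> set_stabilizer A S"
  shows "(\<Sum>u\<in>set_stabilizer A S. f (u \<circ> v)) = (\<Sum>u\<in>set_stabilizer A S. f u)"
  by (rule sum.reindex_bij_witness[of _ "\<lambda>u. u \<circ> inv v" "\<lambda>u. u \<circ> v"])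
     (use assms set_stabilizer_comp set_stabilizer_inv in \<open>auto simp: set_stabilizer_def o_assoc[symmetric] permutes_inv_o\<close>)

text \<open>Replacing \<open>u\<close> by the identity outside \<open>S\<close> keeps its cycles on
  \<open>S\<close>, so the sign formula on \<open>S\<close> applies. The alternating weight of a
  stable set thereby becomes a character of the stabilizer.\<close>

lemma sign_on_set_stabilizer:
  assumes "u \<in> set_stabilizer A S"
  shows "(-1) ^ card (cycles_on u S) = (-1) ^ card S * (of_int (sign_on S u) :: 'b::comm_ring_1)"
proof -
  have u: "u ` S = S" using assms by (auto simp: set_stabilizer_def)
  have "cycles_on (restrict_id u S) S = cycles_on u S"
    by (intro image_cong refl orbit_cong0[of _ S]) (use u in auto)
  then show ?thesis
    using sign_eq_cycles_on[OF permutes_restrict_id[OF set_stabilizer_bij[OF assms]]] 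
      finite_subset[OF sub fin] unfolding sign_on_def by metis
qed

lemma sign_on_set_stabilizer_comp:
  assumes "u \<in> set_stabilizer A S" "v \<in> set_stabilizer A S"
  shows "sign_on S (u \<circ> v) = sign_on S u * sign_on S v"
  using assms by (intro sign_on_compose set_stabilizer_bij finite_subset[OF sub fin])

lemma card_cycles_on_set_stabilizer:
  assumes "u \<in> set_stabilizer A S"
  shows "card (cycles_on u A) = card (cycles_on u S) + card (cycles_on u (A - S))"
proof -
  have u: "u ` S = S" using assms by (auto simp: set_stabilizer_def)
  have "A = S \<union> (A - S)" using sub by auto
  then have "cycles_on u A = cycles_on u S \<union> cycles_on u (A - S)" by (metis image_Un)
  moreover have "cycles_on u S \<inter> cycles_on u (A - S) = {}"
  proof (rule equals0I)
    fix C assume "C \<in> cycles_on u S \<inter> cycles_on u (A - S)"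
    then obtain x y where xy: "x \<in> S" "C = orbit u x" "y \<in> A - S" "C = orbit u y" by auto
    have "orbit u x \<subseteq> S" by (rule orbit_subset_stable) (simp_all add: xy(1) u)
    moreover have "orbit u y \<subseteq> A - S"
      by (rule orbit_subset_stable) (use xy(3) set_stabilizer_Compl[OF assms] in blast)+
    ultimately show False using xy orbit_nonempty[of u x] by blast
  qed
  moreover have "finite S" using finite_subset[OF sub fin] .
  ultimately show ?thesis using fin by (simp add: card_Un_disjoint)
qed

text \<open>A stabilizing permutation is a pair of permutations of \<open>S\<close> and
  \<open>A - S\<close>, so the sum factors into two cycle counts.\<close>

lemma sum_set_stabilizer_cycles:
  fixes a b :: "'b::comm_ring_1"
  shows "(\<Sum>u\<in>set_stabilizer A S. a ^ card (cycles_on u S) * b ^ card (cycles_on u (A - S))) =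
    pochhammer a (card S) * pochhammer b (card (A - S))"
proof -
  let ?T = "A - S"
  have fS: "finite S" using fin sub finite_subset by auto
  have "pochhammer a (card S) * pochhammer b (card ?T) =
    (\<Sum>u | u permutes S. a ^ card (cycles_on u S)) * (\<Sum>v | v permutes ?T. b ^ card (cycles_on v ?T))"
    using fS fin by (simp add: sum_power_cycles_on)
  also have "\<dots> = (\<Sum>(u, v)\<in>{u. u permutes S} \<times> {v. v permutes ?T}. 
      a ^ card (cycles_on u S) * b ^ card (cycles_on v ?T))"
    by (simp add: sum_product sum.cartesian_product)
  also have "\<dots> = (\<Sum>u\<in>set_stabilizer A S. a ^ card (cycles_on u S) * b ^ card (cycles_on u ?T))"
  proof (rule sum.reindex_bij_witness[of _ "\<lambda>w. (restrict_id w S, restrict_id w ?T)" "\<lambda>(u, v). u \<circ> v"])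
    fix z assume "z \<in> {u. u permutes S} \<times> {v. v permutes ?T}"
    then obtain u v where z: "z = (u, v)" "u permutes S" "v permutes ?T" by auto
    have uA: "u permutes A" "v permutes A"
      using z sub by (auto intro: permutes_subset)
    have vS: "x \<in> S \<Longrightarrow> v x = x" for x using z permutes_not_in[OF z(3)] by auto
    have uT: "x \<in> ?T \<Longrightarrow> u x = x" for x using z permutes_not_in[OF z(2)] by auto
    have v_in: "v x \<in> ?T \<longleftrightarrow> x \<in> ?T" for x using permutes_in_image[OF z(3)] .
    have r1: "restrict_id (u \<circ> v) S = u"
      using vS permutes_not_in[OF z(2)] by (auto simp: fun_eq_iff restrict_id_def)
    have r2: "restrict_id (u \<circ> v) ?T = v"
    proof
      fix x show "restrict_id (u \<circ> v) ?T x = v x"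
        using v_in[of x] uT[of "v x"] permutes_not_in[OF z(3), of x] by (simp add: restrict_id_def)
    qed
    show "(\<lambda>w. (restrict_id w S, restrict_id w ?T)) ((\<lambda>(u, v). u \<circ> v) z) = z"
      using r1 r2 z by simp
    have "(u \<circ> v) ` S = u ` S" using vS by auto
    then have S: "(u \<circ> v) ` S = S" using permutes_image[OF z(2)] by simp
    then show "(\<lambda>(u, v). u \<circ> v) z \<in> set_stabilizer A S"
      using uA z by (auto simp: set_stabilizer_def permutes_compose)
    have c1: "cycles_on (u \<circ> v) S = cycles_on u S"
      by (intro image_cong refl orbit_cong0[of _ S]) (use S vS in auto)
    have "v ` ?T = ?T" using permutes_image[OF z(3)] .
    then have "(u \<circ> v) ` ?T = ?T" using uT v_in by (auto simp: image_comp[symmetric] simp del: image_comp)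
    then have c2: "cycles_on (u \<circ> v) ?T = cycles_on v ?T"
      by (intro image_cong refl orbit_cong0[of _ ?T]) (use uT v_in in auto)
    show "a ^ card (cycles_on ((\<lambda>(u, v). u \<circ> v) z) S) * b ^ card (cycles_on ((\<lambda>(u, v). u \<circ> v) z) ?T) =
      (case z of (u, v) \<Rightarrow> a ^ card (cycles_on u S) * b ^ card (cycles_on v ?T))"
      using z c1 c2 by simp
  next
    fix w assume w: "w \<in> set_stabilizer A S"
    have wT: "bij_betw w ?T ?T"
      using set_stabilizer_Compl[OF w] w by (auto simp: bij_betw_def set_stabilizer_def intro: permutes_inj_on)
    show "(restrict_id w S, restrict_id w ?T) \<in> {u. u permutes S} \<times> {v. v permutes ?T}"
      using set_stabilizer_bij[OF w] wT by (auto intro: permutes_restrict_id)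
    have "restrict_id w S (restrict_id w ?T x) = w x" for x
    proof (cases "x \<in> ?T")
      case True
      then have "w x \<in> ?T" using set_stabilizer_Compl[OF w] by auto
      then show ?thesis using True by simp
    next
      case False
      then show ?thesis using w permutes_not_in[of w A x] by (auto simp: set_stabilizer_def restrict_id_def)
    qed
    then show "(\<lambda>(u, v). u \<circ> v) (restrict_id w S, restrict_id w ?T) = w" by (auto simp: fun_eq_iff)
  qed
  finally show ?thesis by simp
qed

end

section \<open>Signed sums over cosets of a stabilizer\<close>

text \<open>Up to sign, \<open>pochhammer (- q) k\<close> is \<open>(q - k + 1) \<cdots> q\<close>,
  which overlaps \<open>q \<cdots> (q + m - 1)\<close> in the factor \<open>q\<close>. One copy of
  \<open>q\<close> is set aside, and the rest is a single run of consecutive factors.\<close>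

lemma pochhammer_minus_mult_pochhammer:
  fixes q :: "'b::comm_ring_1"
  assumes "k \<ge> 1"
  shows "pochhammer (- q) k * pochhammer q m =
    (-1) ^ k * (q * pochhammer (q - of_nat k + 1) (k + m - 1))"
proof -
  obtain j where j: "k = Suc j" using assms by (cases k) auto
  have "pochhammer (q - of_nat k + 1) (k + m - 1) = pochhammer (q - of_nat k + 1) j * pochhammer q m"
    using pochhammer_product'[of "q - of_nat k + 1" j m] j by (simp add: algebra_simps)
  moreover have "pochhammer (- q) k = (-1) ^ k * (pochhammer (q - of_nat k + 1) j * q)"
    unfolding pochhammer_minus using j by (simp add: pochhammer_Suc algebra_simps)
  ultimately show ?thesis by (simp add: algebra_simps)
qed

lemma transpose_image_remove:
  assumes "c \<in> S" "b \<notin> S"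
  shows "transpose c b ` S = insert b (S - {c})"
proof -
  have "transpose c b ` (S - {c}) = (\<lambda>x. x) ` (S - {c})"
    by (rule image_cong) (use assms in \<open>auto simp: transpose_def\<close>)
  then have "transpose c b ` insert c (S - {c}) = insert b (S - {c})"
    by (simp only: image_insert transpose_apply_first image_ident)
  then show ?thesis using assms(1) by (simp only: insert_Diff)
qed

text \<open>The weight is the character of the stabilizer that is the sign on \<open>S\<close> and
  trivial on \<open>A - S\<close>, taken along the coset of \<open>w\<close>.\<close>

definition coset_sum :: "'a set \<Rightarrow> 'a set \<Rightarrow> ('a \<Rightarrow> 'a) \<Rightarrow> 'b::field_char_0 \<Rightarrow> 'b" where
  "coset_sum A S w q = (\<Sum>u\<in>set_stabilizer A S. of_int (sign_on S u) * q ^ card (cycles_on (u \<circ> w) A))"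

context
  fixes A S :: "'a set" and q :: "'b::field_char_0"
  assumes fin: "finite A" and sub: "S \<subseteq> A"
begin

text \<open>Absorbing the sign changes the weight of each cycle inside \<open>S\<close> from
  \<open>q\<close> to \<open>- q\<close>; the sum then factors, and the two rising factorials join
  into one.\<close>

lemma coset_sum_id:
  assumes "S \<noteq> {}"
  shows "coset_sum A S id q = q * pochhammer (q - of_nat (card S) + 1) (card A - 1)"
proof -
  have fS: "finite S" using finite_subset[OF sub fin] .
  have S1: "card S \<ge> 1" using assms fS by (simp add: Suc_leI card_gt_0_iff)
  have cA: "card S + card (A - S) = card A" using fS fin sub by (metis card_Diff_subset card_mono le_add_diff_inverse)
  have "(-1) ^ card S * coset_sum A S id q = 
    (\<Sum>u\<in>set_stabilizer A S. (- q) ^ card (cycles_on u S) * q ^ card (cycles_on u (A - S)))"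
    unfolding coset_sum_def sum_distrib_left
  proof (rule sum.cong)
    fix u assume u: "u \<in> set_stabilizer A S"
    have "(- q) ^ card (cycles_on u S) = (-1) ^ card (cycles_on u S) * q ^ card (cycles_on u S)"
      by (rule power_minus)
    then show "(-1) ^ card S * (of_int (sign_on S u) * q ^ card (cycles_on (u \<circ> id) A)) =
      (- q) ^ card (cycles_on u S) * q ^ card (cycles_on u (A - S))"
      using sign_on_set_stabilizer[OF fin sub u, where 'b = 'b] card_cycles_on_set_stabilizer[OF fin sub u]
      by (simp add: power_add mult_ac)
  qed simp
  also have "\<dots> = (-1) ^ card S * (q * pochhammer (q - of_nat (card S) + 1) (card A - 1))"
    unfolding sum_set_stabilizer_cycles[OF fin sub] pochhammer_minus_mult_pochhammer[OF S1] cA ..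
  finally show ?thesis by simp
qed

lemma sign_on_mult_self: "of_int (sign_on S u) * (of_int (sign_on S u) * x) = (x :: 'b)"
  by (simp add: sign_on_def mult.assoc[symmetric] of_int_mult[symmetric] del: of_int_mult)

text \<open>Substituting \<open>u \<circ> v\<close> for \<open>u\<close> permutes the summands up to
  the sign of \<open>v\<close>.\<close>

lemma coset_sum_stabilizer_left:
  assumes "v \<in> set_stabilizer A S"
  shows "coset_sum A S (v \<circ> w) q = of_int (sign_on S v) * coset_sum A S w q"
proof -
  have "coset_sum A S w q = (\<Sum>u\<in>set_stabilizer A S. of_int (sign_on S (u \<circ> v)) * q ^ card (cycles_on ((u \<circ> v) \<circ> w) A))"
    unfolding coset_sum_def by (rule sum_set_stabilizer_right[OF fin sub assms, symmetric])
  also have "\<dots> = (\<Sum>u\<in>set_stabilizer A S. of_int (sign_on S v) *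
      (of_int (sign_on S u) * q ^ card (cycles_on (u \<circ> (v \<circ> w)) A)))"
    by (rule sum.cong)
       (simp_all only: sign_on_set_stabilizer_comp[OF fin sub _ assms] o_assoc of_int_mult mult_ac)
  finally show ?thesis unfolding coset_sum_def sum_distrib_left[symmetric] 
    by (simp only: sign_on_mult_self)
qed

text \<open>After substituting \<open>v \<circ> u\<close> for \<open>u\<close>, the factor
  \<open>v\<close> can be moved cyclically to the right end without changing the number of
  cycles.\<close>

lemma coset_sum_stabilizer_right:
  assumes "v \<in> set_stabilizer A S" "w permutes A"
  shows "coset_sum A S (w \<circ> v) q = of_int (sign_on S v) * coset_sum A S w q"
proof -
  have v: "v permutes A" using assms by (simp add: set_stabilizer_def)
  have "coset_sum A S w q = (\<Sum>u\<in>set_stabilizer A S. of_int (sign_on S (v \<circ> u)) * q ^ card (cycles_on ((v \<circ> u) \<circ> w) A))"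
    unfolding coset_sum_def by (rule sum_set_stabilizer_left[OF fin sub assms(1), symmetric])
  also have "\<dots> = (\<Sum>u\<in>set_stabilizer A S. of_int (sign_on S v) *
      (of_int (sign_on S u) * q ^ card (cycles_on (u \<circ> (w \<circ> v)) A)))"
  proof (rule sum.cong)
    fix u assume u: "u \<in> set_stabilizer A S"
    then have uw: "u \<circ> w permutes A" using assms(2) by (simp add: set_stabilizer_def permutes_compose)
    have "card (cycles_on ((v \<circ> u) \<circ> w) A) = card (cycles_on (u \<circ> (w \<circ> v)) A)"
      using card_cycles_on_comp_commute[OF v uw fin] by (simp add: o_assoc)
    then show "of_int (sign_on S (v \<circ> u)) * q ^ card (cycles_on ((v \<circ> u) \<circ> w) A) = of_int (sign_on S v) *
      (of_int (sign_on S u) * q ^ card (cycles_on (u \<circ> (w \<circ> v)) A))"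
      by (simp only: sign_on_set_stabilizer_comp[OF fin sub assms(1) u] of_int_mult mult.assoc)
  qed simp
  finally show ?thesis unfolding coset_sum_def sum_distrib_left[symmetric] 
    by (simp only: sign_on_mult_self)
qed

lemma transpose_set_stabilizer:
  assumes "a \<in> S \<and> b \<in> S \<or> a \<in> A - S \<and> b \<in> A - S"
  shows "transpose a b \<in> set_stabilizer A S"
proof -
  have "transpose a b ` S = S"
  proof (cases "a \<in> S \<and> b \<in> S")
    case True
    then show ?thesis by (intro permutes_image permutes_swap_id) auto
  next
    case False
    then have "transpose a b ` S = (\<lambda>x. x) ` S"
      by (intro image_cong) (use assms in \<open>auto simp: transpose_def\<close>)
    then show ?thesis by simp
  qed
  moreover have "a \<in> A" "b \<in> A" using assms sub by auto
  ultimately show ?thesis by (simp add: set_stabilizer_def permutes_swap_id)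
qed

text \<open>Swapping \<open>a\<close> and \<open>a'\<close> before \<open>w\<close> amounts to
  swapping their images after \<open>w\<close>. On \<open>S\<close> the first transposition has sign
  \<open>-1\<close>, and the second has sign \<open>1\<close> since both images lie outside
  \<open>S\<close>; hence the sum equals its negative.\<close>

lemma coset_sum_eq_0:
  assumes w: "w permutes A" and a: "a \<in> S" "a' \<in> S" "a \<noteq> a'" "w a \<notin> S" "w a' \<notin> S"
  shows "coset_sum A S w q = 0"
proof -
  have wA: "w a \<in> A - S" "w a' \<in> A - S" using a sub permutes_in_image[OF w] by auto
  have comm: "w \<circ> transpose a a' = transpose (w a) (w a') \<circ> w"
    using permutes_inj[OF w] by (auto simp: fun_eq_iff transpose_def inj_eq)
  have "w a \<noteq> w a'" using a permutes_inj[OF w] by (simp add: inj_eq)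
  have s1: "sign_on S (transpose a a') = -1"
    using a by (intro sign_on_transpose) auto
  have "sign_on S (transpose (w a) (w a')) = sign_on S id"
    using a by (intro sign_on_cong) (auto simp: transpose_def)
  then have s2: "sign_on S (transpose (w a) (w a')) = 1" by simp
  have "coset_sum A S (w \<circ> transpose a a') q = - coset_sum A S w q"
    using coset_sum_stabilizer_right[OF transpose_set_stabilizer w, of a a'] a s1 by simp
  moreover have "coset_sum A S (w \<circ> transpose a a') q = coset_sum A S w q"
    unfolding comm using coset_sum_stabilizer_left[OF transpose_set_stabilizer, of "w a" "w a'" w] wA s2 by simp
  ultimately show ?thesis by simp
qed

text \<open>Every \<open>u\<close> in the stabilizer has \<open>c\<close> and \<open>b\<close> in
  different cycles, so the transposition always costs exactly one cycle.\<close>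

lemma coset_sum_transpose:
  assumes "c \<in> S" "b \<in> A - S"
  shows "q * coset_sum A S (transpose c b) q = coset_sum A S id q"
  unfolding coset_sum_def sum_distrib_left
proof (rule sum.cong)
  fix u assume u: "u \<in> set_stabilizer A S"
  then have up: "u permutes A" "u ` S = S" by (auto simp: set_stabilizer_def)
  have c: "c \<in> A" "b \<in> A" using assms sub by auto
  have "orbit u c \<subseteq> S" by (rule orbit_subset_stable) (simp_all add: up assms)
  then have ne: "orbit u c \<noteq> orbit u b"
    using permutes_self_in_orbit[OF up(1) fin, of b] assms(2) by blast
  have "card (cycles_on (u \<circ> transpose c b) A) = card (cycles_on (transpose c b \<circ> u) A)"
    by (rule card_cycles_on_comp_commute[OF up(1) permutes_swap_id[OF c] fin])
  then have "Suc (card (cycles_on (u \<circ> transpose c b) A)) = card (cycles_on u A)"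
    using card_cycles_on_merge[OF up(1) fin c ne] by (simp only:)
  then have "q ^ card (cycles_on (u \<circ> id) A) = q * q ^ card (cycles_on (u \<circ> transpose c b) A)"
    by (metis power_Suc comp_id)
  then show "q * (of_int (sign_on S u) * q ^ card (cycles_on (u \<circ> transpose c b) A)) =
    of_int (sign_on S u) * q ^ card (cycles_on (u \<circ> id) A)"
    by (simp only: mult.left_commute)
qed simp

text \<open>Up to sign, the sum depends only on the double coset of \<open>w\<close> modulo the stabilizer, that is, on the
  number of points that \<open>w\<close> moves out of \<open>S\<close>; if there are at least two, swapping them reverses the sign.\<close>

lemma coset_sum_eq:
  assumes w: "w permutes A" and "S \<noteq> {}" and "q \<noteq> 0"
  defines "B \<equiv> pochhammer (q - of_nat (card S) + 1) (card A - 1)"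
  shows "coset_sum A S w q =
    (if w ` S = S then of_int (sign_on S w) * (q * B) else 0) +
    (\<Sum>(c, b)\<in>{(c, b). c \<in> S \<and> b \<in> A - S \<and> (transpose c b \<circ> w) ` S = S}.
       of_int (sign_on S (transpose c b \<circ> w)) * B)"
    (is "_ = _ + sum ?f ?P")
proof -
  have fS: "finite S" using finite_subset[OF sub fin] .
  have id: "coset_sum A S id q = q * B" unfolding B_def by (rule coset_sum_id[OF assms(2)])
  have card: "card (w ` S) = card S" by (rule card_image) (rule permutes_inj_on[OF w])
  have img: "w ` S = insert b (S - {c})" if "(c, b) \<in> ?P" for c b
  proof -
    have "w ` S = transpose c b ` (transpose c b \<circ> w) ` S"
      by (simp add: image_image)
    also have "\<dots> = transpose c b ` S" using that by simp
    also have "\<dots> = insert b (S - {c})"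
      using that by (intro transpose_image_remove) auto
    finally show ?thesis .
  qed
  \<comment> \<open>A pair in \<open>?P\<close> can be read off from \<open>S\<close> and its image
    under \<open>w\<close>, so \<open>?P\<close> has at most one element, and none if
    \<open>w\<close> stabilizes \<open>S\<close>.\<close>
  have P_img: "w ` S - S = {b}" "S - w ` S = {c}" if "(c, b) \<in> ?P" for c b
    unfolding img[OF that] using that by auto
  consider (stable) "w ` S = S" | (one) c b where "(c, b) \<in> ?P" | (two) "w ` S \<noteq> S" "?P = {}" by auto
  then show ?thesis
  proof cases
    case stable
    have np: "(c, b) \<notin> ?P" for c b using P_img(1)[of c b] stable by blast
    have "?P = {}"
    proof (rule equals0I)
      fix z assume "z \<in> ?P"
      with np[of "fst z" "snd z", unfolded prod.collapse] show False by (rule notE)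
    qed
    moreover have "coset_sum A S w q = of_int (sign_on S w) * (q * B)"
      using coset_sum_stabilizer_left[of w id] stable w id by (simp add: set_stabilizer_def)
    ultimately show ?thesis using stable by (simp only: sum.empty if_True add_0_right simp_thms)
  next
    case one
    have "z = (c, b)" if "z \<in> ?P" for z
    proof -
      obtain c' b' where z: "z = (c', b')" by (cases z)
      have "{b} = {b'}" "{c} = {c'}"
        using P_img[OF that[unfolded z]] unfolding P_img[OF one] by - assumption+
      then show ?thesis unfolding z by simp
    qed
    then have uniq: "?P = {(c, b)}" using one by (intro equalityI subsetI) simp_all
    have ns: "w ` S \<noteq> S" using P_img[OF one] by auto
    let ?v = "transpose c b \<circ> w"
    have cA: "c \<in> A" "b \<in> A" using one sub by auto
    have v: "?v \<in> set_stabilizer A S"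
      using one w cA by (auto simp: set_stabilizer_def permutes_compose permutes_swap_id)
    have "transpose c b \<circ> ?v = w" by (simp add: fun_eq_iff)
    then have "coset_sum A S w q = of_int (sign_on S ?v) * coset_sum A S (transpose c b) q"
      using coset_sum_stabilizer_right[OF v permutes_swap_id[OF cA]] by simp
    \<comment> \<open>\<open>coset_sum_transpose\<close> gives this after cancelling
      \<open>q\<close>, hence the hypothesis \<open>q \<noteq> 0\<close>.\<close>
    moreover have "coset_sum A S (transpose c b) q = B"
      using coset_sum_transpose[of c b] one id assms(3) by simp
    ultimately show ?thesis using ns uniq by simp
  next
    case two
    have "\<not> w ` S \<subseteq> S" using two(1) card fS by (metis card_subset_eq)
    then obtain a where a: "a \<in> S" "w a \<notin> S" by auto
    \<comment> \<open>If only \<open>a\<close> left \<open>S\<close>, then, by equality of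
      cardinalities, the image of \<open>S\<close> would miss exactly one point \<open>c\<close> of
      \<open>S\<close>, and \<open>(c, w a)\<close> would lie in the empty set
      \<open>?P\<close>.\<close>
    have "\<exists>a'\<in>S. a' \<noteq> a \<and> w a' \<notin> S"
    proof (rule ccontr)
      assume "\<not> ?thesis"
      then have d: "w ` S - S = {w a}" using a by auto
      have "card (S - w ` S) = card (w ` S - S)"
        using card fS by (simp add: card_le_sym_Diff card_Diff_subset_Int Int_commute)
      then obtain c where c: "S - w ` S = {c}" using d by (auto simp: card_1_singleton_iff)
      have wa: "w a \<in> A" using a sub permutes_in_image[OF w] by auto
      have "w ` S = insert (w a) (S - {c})" using c d by blast
      also have "\<dots> = transpose c (w a) ` S"
        using c a by (intro transpose_image_remove[symmetric]) auto
      finally have "(transpose c (w a) \<circ> w) ` S = S"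
        by (simp only: image_comp[symmetric]) (simp add: image_image)
      then have "(c, w a) \<in> ?P" using c a wa by auto
      then show False using two by blast
    qed
    then have "coset_sum A S w q = 0" using coset_sum_eq_0[OF w a(1) _ _ a(2)] by blast
    then show ?thesis using two by (simp only: sum.empty if_False add_0_right simp_thms)
  qed
qed

end

subsection \<open>Generating functions of stable sets\<close>

lemma image_orbit_eq:
  assumes "p permutes A" "finite A"
  shows "p ` orbit p x = orbit p x"
proof -
  have "p ` orbit p x = orbit p (p x)"
    by (rule orbit_inverse) (simp_all add: permutes_self_in_orbit[OF assms])
  also have "\<dots> = orbit p x"
    by (rule self_in_orbit_step) (rule permutes_self_in_orbit[OF assms])
  finally show ?thesis .
qed

lemma image_Union_cycles:
  assumes "p permutes A" "finite A" "D \<subseteq> cycles_on p A"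
  shows "p ` \<Union>D = \<Union>D"
proof -
  have "p ` C = C" if "C \<in> D" for C
    using that assms(3) image_orbit_eq[OF assms(1,2)] by auto
  then show ?thesis unfolding image_Union by simp
qed

lemma cycles_on_Union:
  assumes "p permutes A" "finite A" "D \<subseteq> cycles_on p A"
  shows "cycles_on p (\<Union>D) = D"
proof (intro equalityI subsetI)
  fix C assume "C \<in> cycles_on p (\<Union>D)"
  then obtain x C' where x: "x \<in> C'" "C' \<in> D" "C = orbit p x" by auto
  then obtain y where "C' = orbit p y" using assms(3) by auto
  then show "C \<in> D" using x permutes_orbit_eq[OF assms(1,2)] by simp
next
  fix C assume C: "C \<in> D"
  then obtain y where y: "C = orbit p y" using assms(3) by auto
  then have "y \<in> \<Union>D" using C permutes_self_in_orbit[OF assms(1,2)] by auto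
  then show "C \<in> cycles_on p (\<Union>D)" using y by auto
qed

text \<open>A stable set is the union of the cycles it contains, so \<open>Union\<close> and
  \<open>cycles_on p\<close> are mutually inverse bijections.\<close>

lemma sum_stable_sets:
  assumes "p permutes A" "finite A"
  shows "(\<Sum>S | S \<subseteq> A \<and> p ` S = S \<and> P S. g (cycles_on p S)) =
    (\<Sum>D | D \<subseteq> cycles_on p A \<and> P (\<Union>D). g D)"
proof (rule sum.reindex_bij_witness[of _ Union "\<lambda>S. cycles_on p S"])
  fix S assume S: "S \<in> {S. S \<subseteq> A \<and> p ` S = S \<and> P S}"
  then show "\<Union>(cycles_on p S) = S" using Union_cycles_on[OF assms] by simp
  then show "cycles_on p S \<in> {D. D \<subseteq> cycles_on p A \<and> P (\<Union>D)}" using S by auto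
next
  fix D assume D: "D \<in> {D. D \<subseteq> cycles_on p A \<and> P (\<Union>D)}"
  then show "cycles_on p (\<Union>D) = D" using cycles_on_Union[OF assms] by simp
  have "\<Union>D \<subseteq> A" using D cycles_on_subset[OF assms(1)] by blast
  then show "\<Union>D \<in> {S. S \<subseteq> A \<and> p ` S = S \<and> P S}"
    using D image_Union_cycles[OF assms, of D] by simp
qed simp

lemma prod_one_plus:
  fixes f :: "'x \<Rightarrow> 'b::comm_ring_1"
  assumes "finite X"
  shows "(\<Prod>x\<in>X. 1 + f x) = (\<Sum>D\<in>Pow X. \<Prod>x\<in>D. f x)"
  using prod_add[OF assms, of f "\<lambda>_. 1"] by (simp add: add.commute)

lemma sum_stable_sets_prod:
  fixes f :: "'a set \<Rightarrow> 'b::comm_ring_1"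
  assumes "p permutes A" "finite A"
  shows "(\<Sum>S | S \<subseteq> A \<and> p ` S = S. \<Prod>C\<in>cycles_on p S. f C) = (\<Prod>C\<in>cycles_on p A. 1 + f C)"
proof -
  have "(\<Sum>S | S \<subseteq> A \<and> p ` S = S. \<Prod>C\<in>cycles_on p S. f C) = (\<Sum>D | D \<subseteq> cycles_on p A. \<Prod>C\<in>D. f C)"
    using sum_stable_sets[OF assms, where P = "\<lambda>_. True" and g = "\<lambda>D. \<Prod>C\<in>D. f C"] by simp
  also have "\<dots> = (\<Prod>C\<in>cycles_on p A. 1 + f C)"
    using prod_one_plus[of "cycles_on p A" f] assms(2) by (simp add: Pow_def)
  finally show ?thesis .
qed

text \<open>Such a set contains the whole cycle of \<open>c\<close> and avoids the whole cycle of
  \<open>b\<close>; every other cycle may be chosen freely.\<close>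

lemma sum_separating_stable_sets_prod:
  fixes f :: "'a set \<Rightarrow> 'b::comm_ring_1"
  assumes p: "p permutes A" "finite A" and c: "c \<in> A" and b: "b \<in> A" and ne: "orbit p c \<noteq> orbit p b"
  shows "(\<Sum>S | S \<subseteq> A \<and> p ` S = S \<and> (c \<in> S \<and> b \<notin> S). \<Prod>C\<in>cycles_on p S. f C) =
    f (orbit p c) * (\<Prod>C\<in>cycles_on p A - {orbit p c, orbit p b}. 1 + f C)"
proof -
  let ?X = "cycles_on p A - {orbit p c, orbit p b}"
  have mem: "x \<in> \<Union>D \<longleftrightarrow> orbit p x \<in> D" if D: "D \<subseteq> cycles_on p A" for x D
  proof
    assume "x \<in> \<Union>D"
    then obtain C where C: "x \<in> C" "C \<in> D" by blast
    then obtain y where "C = orbit p y" using D by auto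
    then show "orbit p x \<in> D" using C permutes_orbit_eq[OF p] by simp
  next
    assume "orbit p x \<in> D" then show "x \<in> \<Union>D" using permutes_self_in_orbit[OF p] by auto
  qed
  have "{D. D \<subseteq> cycles_on p A \<and> (c \<in> \<Union>D \<and> b \<notin> \<Union>D)} = insert (orbit p c) ` Pow ?X" (is "?L = ?R")
  proof (intro equalityI subsetI)
    fix D assume "D \<in> ?L"
    then have D: "D \<subseteq> cycles_on p A" "c \<in> \<Union>D" "b \<notin> \<Union>D" by blast+
    then have D: "D \<subseteq> cycles_on p A" "orbit p c \<in> D" "orbit p b \<notin> D"
      unfolding mem[OF D(1)] by - assumption+
    then have "D - {orbit p c} \<in> Pow ?X" by blast
    moreover have "D = insert (orbit p c) (D - {orbit p c})" using D by blast
    ultimately show "D \<in> ?R" by (rule rev_image_eqI)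
  next
    fix D assume "D \<in> ?R"
    then obtain D' where D': "D' \<subseteq> ?X" "D = insert (orbit p c) D'" by auto
    have D: "D \<subseteq> cycles_on p A" using D' c by auto
    moreover have "orbit p c \<in> D" "orbit p b \<notin> D" using D' ne by auto
    ultimately show "D \<in> ?L" by (simp only: mem_Collect_eq mem[OF D] simp_thms)
  qed
  then have "(\<Sum>S | S \<subseteq> A \<and> p ` S = S \<and> (c \<in> S \<and> b \<notin> S). \<Prod>C\<in>cycles_on p S. f C) =
    (\<Sum>D\<in>insert (orbit p c) ` Pow ?X. \<Prod>C\<in>D. f C)"
    using sum_stable_sets[OF p, where P = "\<lambda>S. c \<in> S \<and> b \<notin> S" and g = "\<lambda>D. \<Prod>C\<in>D. f C"]
    by (simp only:)
  also have "\<dots> = (\<Sum>D\<in>Pow ?X. \<Prod>C\<in>insert (orbit p c) D. f C)"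
    by (rule sum.reindex_cong[OF _ refl refl]) (rule inj_onI, blast)
  also have "\<dots> = (\<Sum>D\<in>Pow ?X. f (orbit p c) * (\<Prod>C\<in>D. f C))"
  proof (rule sum.cong[OF refl])
    fix D assume D: "D \<in> Pow ?X"
    then have "finite D" using p(2) by (auto intro: finite_subset)
    moreover have "orbit p c \<notin> D" using D by blast
    ultimately show "(\<Prod>C\<in>insert (orbit p c) D. f C) = f (orbit p c) * (\<Prod>C\<in>D. f C)" by simp
  qed
  also have "\<dots> = f (orbit p c) * (\<Prod>C\<in>?X. 1 + f C)"
    using p(2) by (simp add: prod_one_plus sum_distrib_left)
  finally show ?thesis .
qed

section \<open>Signed generating polynomials by size\<close>

lemma prod_monom_one:
  "(\<Prod>x\<in>D. monom (1::'b::comm_ring_1) (f x)) = monom 1 (\<Sum>x\<in>D. f x)"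
  by (induction D rule: infinite_finite_induct) (simp_all add: mult_monom)

lemma monom_stable_set:
  assumes "p permutes A" "finite A" "S \<subseteq> A" "p ` S = S"
  shows "monom ((-1) ^ card (cycles_on p S)) (card S) =
    (\<Prod>C\<in>cycles_on p S. - monom (1::'b::comm_ring_1) (card C))"
proof -
  have "(\<Sum>C\<in>cycles_on p S. card C) = card S"
    using sum_card_cycles_on[OF assms(1,2) image_mono[OF assms(3)]] Union_cycles_on[OF assms] by (simp only:)
  then have "(\<Prod>C\<in>cycles_on p S. - monom (1::'b) (card C)) = 
      (-1) ^ card (cycles_on p S) * monom 1 (card S)"
    using prod.distrib[of "\<lambda>_. - 1" "\<lambda>C. monom (1::'b) (card C)" "cycles_on p S"]
    by (simp add: prod_monom_one)
  also have "\<dots> = monom ((-1) ^ card (cycles_on p S)) (card S)"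
    by (cases "even (card (cycles_on p S))") (simp_all add: minus_monom)
  finally show ?thesis ..
qed

text \<open>Over a field, for the cycles of a permutation of nonempty type \<open>lam\<close>, this
  is \<open>(1 - t) * g_poly lam\<close>, with \<open>t\<close> the monomial
  \<open>monom 1 1\<close>.\<close>

definition cycle_gf :: "'a set set \<Rightarrow> 'b::comm_ring_1 poly" where
  "cycle_gf X = (\<Prod>C\<in>X. 1 - monom 1 (card C))"

lemma sum_stable_sets_monom:
  assumes "p permutes A" "finite A"
  shows "(\<Sum>S | S \<subseteq> A \<and> p ` S = S. monom ((-1) ^ card (cycles_on p S)) (card S)) =
    (cycle_gf (cycles_on p A) :: 'b::comm_ring_1 poly)"
proof -
  have "(\<Sum>S | S \<subseteq> A \<and> p ` S = S. monom ((-1) ^ card (cycles_on p S)) (card S)) =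
    (\<Sum>S | S \<subseteq> A \<and> p ` S = S. \<Prod>C\<in>cycles_on p S. - monom (1::'b) (card C))"
    by (rule sum.cong) (use monom_stable_set[OF assms] in auto)
  then show ?thesis unfolding sum_stable_sets_prod[OF assms] cycle_gf_def by simp
qed

lemma sum_separating_stable_sets_monom:
  assumes "p permutes A" "finite A" "c \<in> A" "b \<in> A" "orbit p c \<noteq> orbit p b"
  shows "(\<Sum>S | S \<subseteq> A \<and> p ` S = S \<and> (c \<in> S \<and> b \<notin> S). monom ((-1) ^ card (cycles_on p S)) (card S)) =
    - monom (1::'b::comm_ring_1) (card (orbit p c)) * cycle_gf (cycles_on p A - {orbit p c, orbit p b})"
proof -
  have "(\<Sum>S | S \<subseteq> A \<and> p ` S = S \<and> (c \<in> S \<and> b \<notin> S). monom ((-1) ^ card (cycles_on p S)) (card S)) =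
    (\<Sum>S | S \<subseteq> A \<and> p ` S = S \<and> (c \<in> S \<and> b \<notin> S). \<Prod>C\<in>cycles_on p S. - monom (1::'b) (card C))"
    by (rule sum.cong) (use monom_stable_set[OF assms(1,2)] in auto)
  then show ?thesis unfolding sum_separating_stable_sets_prod[OF assms] cycle_gf_def by simp
qed

text \<open>Each cycle occurs once for every one of its points.\<close>

lemma sum_orbits:
  fixes f :: "'a set \<Rightarrow> 'b::comm_ring_1"
  assumes "p permutes A" "finite A"
  shows "(\<Sum>x\<in>A. f (orbit p x)) = (\<Sum>C\<in>cycles_on p A. of_nat (card C) * f C)"
proof -
  have "(\<Sum>x\<in>A. f (orbit p x)) = (\<Sum>C\<in>cycles_on p A. \<Sum>x | x \<in> A \<and> orbit p x = C. f (orbit p x))"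
    by (rule sum.image_gen[OF assms(2)])
  also have "\<dots> = (\<Sum>C\<in>cycles_on p A. of_nat (card C) * f C)"
  proof (rule sum.cong[OF refl])
    fix C assume C: "C \<in> cycles_on p A"
    then obtain y where y: "C = orbit p y" by auto
    have "{x. x \<in> A \<and> orbit p x = C} = C"
      using y C cycles_on_subset[OF assms(1) C] permutes_orbit_eq_iff[OF assms] by auto
    moreover have "(\<Sum>x | x \<in> A \<and> orbit p x = C. f (orbit p x)) = (\<Sum>x | x \<in> A \<and> orbit p x = C. f C)"
      by (rule sum.cong) auto
    ultimately show "(\<Sum>x | x \<in> A \<and> orbit p x = C. f (orbit p x)) = of_nat (card C) * f C" by simp
  qed
  finally show ?thesis .
qed

lemma cycle_gf_remove:
  assumes "finite X" "C \<in> X"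
  shows "cycle_gf X = (1 - monom 1 (card C)) * cycle_gf (X - {C})"
  unfolding cycle_gf_def by (rule prod.remove[OF assms])

text \<open>Product rule: \<open>t\<close> times the derivative of \<open>1 - t^k\<close> is
  \<open>k (1 - t^k) - k\<close>. The weights \<open>card C\<close> then become sums over points,
  and \<open>pCons 0\<close> is multiplication by \<open>t\<close>.\<close>

lemma pderiv_cycle_gf:
  fixes w :: "'a \<Rightarrow> 'a"
  assumes "w permutes A" "finite A"
  defines "G \<equiv> cycle_gf (cycles_on w A) :: 'b::field_char_0 poly"
  shows "pCons 0 (pderiv G) = of_nat (card A) * G - (\<Sum>x\<in>A. cycle_gf (cycles_on w A - {orbit w x}))"
proof -
  let ?X = "cycles_on w A"
  have fin: "finite ?X" using assms by simp
  have pos: "card C > 0" if "C \<in> ?X" for C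
    using that orbit_nonempty[of w] cycles_on_subset[OF assms(1) that] assms(2)
    by (auto simp: card_gt_0_iff intro: finite_subset)
  have "of_nat (card A) * G = (\<Sum>x\<in>A. G)" by simp
  also have "\<dots> = (\<Sum>C\<in>?X. of_nat (card C) * G)" by (rule sum_orbits[OF assms(1,2), of "\<lambda>_. G"])
  finally have 1: "of_nat (card A) * G = (\<Sum>C\<in>?X. of_nat (card C) * G)" .
  have 2: "pCons 0 (pderiv G) = monom 1 1 * pderiv G" by (simp add: monom_altdef)
  have 3: "pderiv G = (\<Sum>C\<in>?X. cycle_gf (?X - {C}) * pderiv (1 - monom 1 (card C)))"
    unfolding G_def cycle_gf_def by (rule pderiv_prod)
  have "pCons 0 (pderiv G) = (\<Sum>C\<in>?X. of_nat (card C) * G - of_nat (card C) * cycle_gf (?X - {C}))"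
    unfolding 2 unfolding 3 sum_distrib_left
  proof (rule sum.cong[OF refl])
    fix C assume C: "C \<in> ?X"
    obtain m where m: "card C = Suc m" using pos[OF C] by (cases "card C") auto
    have e: "monom 1 1 * pderiv (1 - monom (1::'b) (card C)) = - (of_nat (card C) * monom 1 (card C))"
      using m by (simp add: pderiv_diff pderiv_monom mult_monom of_nat_poly smult_monom)
    have "monom 1 1 * (cycle_gf (?X - {C}) * pderiv (1 - monom (1::'b) (card C))) =
      (monom 1 1 * pderiv (1 - monom (1::'b) (card C))) * cycle_gf (?X - {C})" by (simp only: mult_ac)
    also have "\<dots> = - (of_nat (card C) * monom 1 (card C)) * cycle_gf (?X - {C})" unfolding e ..
    finally
    show "monom 1 1 * (cycle_gf (?X - {C}) * pderiv (1 - monom (1::'b) (card C))) =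
      of_nat (card C) * G - of_nat (card C) * cycle_gf (?X - {C})"
      unfolding G_def cycle_gf_remove[OF fin C] by (simp add: algebra_simps)
  qed
  also have "\<dots> = of_nat (card A) * G - (\<Sum>C\<in>?X. of_nat (card C) * cycle_gf (?X - {C}))"
    unfolding 1 by (rule sum_subtractf)
  finally show ?thesis
    unfolding sum_orbits[OF assms(1,2), of "\<lambda>C. cycle_gf (?X - {C}) :: 'b poly"] .
qed

text \<open>The sum is the derivative at \<open>1\<close> of the product over the cycles. All
  factors vanish at \<open>1\<close>, so the derivative survives only if there is a single
  factor.\<close>

lemma full_cycle_indicator:
  assumes "p permutes A" "finite A" "A \<noteq> {}"
  shows "(\<Sum>S | S \<subseteq> A \<and> p ` S = S. of_nat (card S) * (-1) ^ card (cycles_on p S)) =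
    (if cycles_on p A = {A} then - of_nat (card A) else (0 :: 'b::field_char_0))"
proof -
  let ?X = "cycles_on p A"
  let ?F = "\<lambda>S. monom ((-1) ^ card (cycles_on p S)) (card S) :: 'b poly"
  have G0: "poly (cycle_gf Y :: 'b poly) 1 = (if Y = {} then 1 else 0)" if "finite Y" for Y :: "'a set set"
    using that by (auto simp: cycle_gf_def poly_prod poly_monom)
  have "(\<Sum>S | S \<subseteq> A \<and> p ` S = S. of_nat (card S) * (-1) ^ card (cycles_on p S)) =
    poly (pderiv (\<Sum>S | S \<subseteq> A \<and> p ` S = S. ?F S)) (1::'b)"
    by (simp add: higher_pderiv_sum[of "Suc 0", simplified] poly_sum pderiv_monom poly_monom)
  \<comment> \<open>Multiplication by \<open>t\<close> does not affect the value at \<open>1\<close>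
    and brings the derivative into the form of \<open>pderiv_cycle_gf\<close>.\<close>
  also have "\<dots> = poly (pCons 0 (pderiv (cycle_gf ?X))) (1::'b)"
    unfolding sum_stable_sets_monom[OF assms(1,2)] by simp
  also have "\<dots> = - (\<Sum>x\<in>A. if ?X - {orbit p x} = {} then 1 else (0::'b))"
    unfolding pderiv_cycle_gf[OF assms(1,2)] using assms by (simp add: poly_sum G0)
  also have "\<dots> = (if cycles_on p A = {A} then - of_nat (card A) else (0 :: 'b))"
  proof (cases "?X = {A}")
    case True
    have "orbit p x = A" if "x \<in> A" for x using True that by blast
    then show ?thesis using True by simp
  next
    case False
    have "?X - {orbit p x} \<noteq> {}" if "x \<in> A" for x
    proof
      assume "?X - {orbit p x} = {}"
      then have "?X = {orbit p x}" using that by blast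
      then have "\<Union>?X = orbit p x" by simp
      then show False using Union_cycles_on[OF assms(1,2) subset_refl permutes_image[OF assms(1)]]
        \<open>?X = {orbit p x}\<close> False by simp
    qed
    then show ?thesis using False by simp
  qed
  finally show ?thesis .
qed

section \<open>Stable sets separated by a transposition\<close>

text \<open>Regroups the second sum of \<open>coset_sum_eq\<close>: the pair \<open>(c, b)\<close>
  is fixed and the set \<open>S\<close> varies.\<close>

definition cut_gf :: "'a set \<Rightarrow> ('a \<Rightarrow> 'a) \<Rightarrow> 'a \<Rightarrow> 'a \<Rightarrow> 'b::comm_ring_1 poly" where
  "cut_gf A w c b = (\<Sum>S | S \<subseteq> A \<and> (transpose c b \<circ> w) ` S = S \<and> (c \<in> S \<and> b \<notin> S).
     monom ((-1) ^ card (cycles_on (transpose c b \<circ> w) S)) (card S))"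

text \<open>If the cycles of \<open>c\<close> and \<open>b\<close> differ, the product merges them,
  and a stable set containing \<open>c\<close> contains \<open>b\<close>; for \<open>b = c\<close>
  the membership conditions contradict each other.\<close>

lemma cut_gf_eq_0:
  assumes w: "w permutes A" "finite A" and c: "c \<in> A" "b \<in> A" and "b = c \<or> b \<notin> orbit w c"
  shows "cut_gf A w c b = 0"
proof -
  have False if S: "S \<subseteq> A" "(transpose c b \<circ> w) ` S = S" "c \<in> S" "b \<notin> S" for S
  proof -
    have ne: "orbit w c \<noteq> orbit w b"
      using assms(5) S(3,4) permutes_self_in_orbit[OF w] by blast
    have "b \<in> orbit (transpose c b \<circ> w) c"
      unfolding orbit_transpose_comp_merge[OF w c ne] using permutes_self_in_orbit[OF w] by blast
    moreover have "orbit (transpose c b \<circ> w) c \<subseteq> S"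
      by (rule orbit_subset_stable) (simp_all only: S subset_refl)
    ultimately show False using S(4) by blast
  qed
  then have none: "{S. S \<subseteq> A \<and> (transpose c b \<circ> w) ` S = S \<and> (c \<in> S \<and> b \<notin> S)} = {}" by blast
  show ?thesis unfolding cut_gf_def none by (rule sum.empty)
qed

text \<open>The product splits the cycle of \<open>c\<close> into a part of length \<open>d\<close>
  through \<open>c\<close> and a part through \<open>b\<close>. The first is forced into
  \<open>S\<close> and gives \<open>- t^d\<close>, the second is forced out, and the free cycles are
  the other cycles of \<open>w\<close>.\<close>

lemma cut_gf_split:
  assumes w: "w permutes A" "finite A" and c: "c \<in> A" and d: "0 < d" "d < card (orbit w c)"
  shows "cut_gf A w c ((w ^^ d) c) =
    - monom (1 :: 'b::comm_ring_1) d * cycle_gf (cycles_on w A - {orbit w c})"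
proof -
  define b where "b = (w ^^ d) c"
  let ?p = "transpose c b \<circ> w"
  have b_orb: "b \<in> orbit w c"
    unfolding b_def by (rule funpow_in_orbit) (rule permutes_self_in_orbit[OF w])
  then have b: "b \<in> A" using permutes_orbit_subset[OF w(1) c] by blast
  note split = orbit_transpose_comp_split[OF w c d, folded b_def]
  have p: "?p permutes A" using w c b by (simp add: permutes_compose permutes_swap_id)
  have ne: "orbit ?p c \<noteq> orbit ?p b" 
    using split(3) permutes_self_in_orbit[OF p w(2), of b] by metis
  have pw: "transpose c b \<circ> ?p = w" by (simp add: fun_eq_iff)
  have oc: "orbit w c = orbit ?p c \<union> orbit ?p b"
    using orbit_transpose_comp_merge[OF p w(2) c b ne] unfolding pw .
  have cyc: "cycles_on w A = insert (orbit w c) (cycles_on ?p A - {orbit ?p c, orbit ?p b})"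
    using cycles_on_transpose_comp_merge[OF p w(2) c b ne] unfolding pw oc .
  have "orbit w c \<notin> cycles_on ?p A - {orbit ?p c, orbit ?p b}"
  proof
    assume "orbit w c \<in> cycles_on ?p A - {orbit ?p c, orbit ?p b}"
    then obtain x where x: "orbit w c = orbit ?p x" "orbit w c \<noteq> orbit ?p c" by auto
    have "c \<in> orbit ?p x" unfolding x(1)[symmetric] by (rule permutes_self_in_orbit[OF w])
    then show False using x permutes_orbit_eq[OF p w(2)] by metis
  qed
  then have rem: "cycles_on w A - {orbit w c} = cycles_on ?p A - {orbit ?p c, orbit ?p b}"
    unfolding cyc by blast
  show ?thesis
    unfolding b_def[symmetric] cut_gf_def rem
    unfolding sum_separating_stable_sets_monom[OF p w(2) c b ne] split(2) ..
qed

text \<open>Only the \<open>b\<close> in the cycle of \<open>c\<close> contribute, and their terms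
  \<open>- t^d\<close> form a geometric sum that \<open>1 - t\<close> telescopes.\<close>

lemma sum_cut_gf:
  assumes w: "w permutes A" "finite A" and c: "c \<in> A"
  shows "(1 - monom 1 1) * (\<Sum>b\<in>A. cut_gf A w c b) =
    (1 - monom 1 1) * cycle_gf (cycles_on w A - {orbit w c}) - (cycle_gf (cycles_on w A) :: 'b::comm_ring_1 poly)"
proof -
  let ?G = "cycle_gf (cycles_on w A - {orbit w c}) :: 'b poly"
  let ?m = "card (orbit w c)"
  have sub: "orbit w c \<subseteq> A" using permutes_orbit_subset[OF w(1) c] .
  have self: "c \<in> orbit w c" by (rule permutes_self_in_orbit[OF w])
  have m: "?m > 0" using self sub w(2) by (auto simp: card_gt_0_iff intro: finite_subset)
  have inj: "inj_on (\<lambda>n. (w ^^ n) c) {0..<funpow_dist1 w c c}" by (rule inj_on_funpow_dist1[OF self])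
  have orb: "orbit w c = (\<lambda>n. (w ^^ n) c) ` {0..<funpow_dist1 w c c}"
    by (rule orbit_conv_funpow_dist1[OF self])
  have N: "?m = funpow_dist1 w c c" using card_image[OF inj] orb by simp
  have "bij_betw (\<lambda>n. (w ^^ n) c) {0..<?m} (orbit w c)"
    unfolding bij_betw_def N using inj orb by simp
  then have bij: "(\<Sum>b\<in>orbit w c. cut_gf A w c b :: 'b poly) = (\<Sum>d\<in>{0..<?m}. cut_gf A w c ((w ^^ d) c))"
    by (rule sum.reindex_bij_betw[symmetric])
  have "(\<Sum>b\<in>A. cut_gf A w c b :: 'b poly) = (\<Sum>b\<in>orbit w c. cut_gf A w c b)"
  proof (rule sum.mono_neutral_right[OF w(2) sub], rule ballI)
    fix b assume "b \<in> A - orbit w c"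
    then show "cut_gf A w c b = (0 :: 'b poly)" by (intro cut_gf_eq_0[OF w c]) auto
  qed
  also have "\<dots> = (\<Sum>d\<in>{0..<?m}. cut_gf A w c ((w ^^ d) c))" by (rule bij)
  \<comment> \<open>The vanishing term for \<open>d = 0\<close> is written as
    \<open>?G - monom 1 0 * ?G\<close>, which completes the geometric sum.\<close>
  also have "\<dots> = (\<Sum>d\<in>{0..<?m}. (if d = 0 then ?G else 0) - monom 1 d * ?G)"
  proof (rule sum.cong[OF refl])
    fix d assume "d \<in> {0..<?m}"
    then show "cut_gf A w c ((w ^^ d) c) = (if d = 0 then ?G else 0) - monom 1 d * ?G"
      using cut_gf_split[OF w c, of d] cut_gf_eq_0[OF w c c] by (cases "d = 0") simp_all
  qed
  also have "\<dots> = ?G - (\<Sum>d<?m. monom 1 d) * ?G"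
    using m by (simp add: sum_subtractf sum_distrib_right lessThan_atLeast0)
  finally have S: "(\<Sum>b\<in>A. cut_gf A w c b) = ?G - (\<Sum>d<?m. monom 1 d) * ?G" .
  have geo: "(1 - monom 1 1) * (\<Sum>d<?m. monom 1 d) = 1 - monom (1::'b) ?m"
    by (simp add: monom_altdef one_diff_power_eq)
  have "orbit w c \<in> cycles_on w A" using c by simp
  then have G: "(cycle_gf (cycles_on w A) :: 'b poly) = (1 - monom 1 ?m) * ?G"
    using w(2) by (intro cycle_gf_remove) auto
  show ?thesis unfolding S G geo[symmetric] by (simp add: algebra_simps)
qed

section \<open>Linear functionals of the coefficients\<close>

text \<open>The linear functional sending \<open>t^k\<close> to \<open>f k\<close>. For
  \<open>f k = h(q - k)\<close> it is the value at \<open>q\<close> of \<open>p(E) h\<close>, where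
  \<open>E\<close> is the backward shift.\<close>

definition coeff_sum :: "(nat \<Rightarrow> 'b) \<Rightarrow> 'b::comm_ring_1 poly \<Rightarrow> 'b" where
  "coeff_sum f p = (\<Sum>k\<le>degree p. coeff p k * f k)"

lemma coeff_sum_eq:
  assumes "degree p \<le> N"
  shows "coeff_sum f p = (\<Sum>k\<le>N. coeff p k * f k)"
  unfolding coeff_sum_def by (rule sum.mono_neutral_left) (use assms in \<open>auto simp: coeff_eq_0\<close>)

lemma coeff_sum_0 [simp]: "coeff_sum f 0 = 0"
  by (simp add: coeff_sum_def)

lemma coeff_sum_add: "coeff_sum f (p + r) = coeff_sum f p + coeff_sum f r"
proof -
  let ?N = "max (degree p) (degree r)"
  have "degree (p + r) \<le> ?N" by (rule degree_add_le_max)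
  then show ?thesis
    by (simp add: coeff_sum_eq[of _ ?N] algebra_simps sum.distrib)
qed

lemma coeff_sum_minus: "coeff_sum f (- p) = - coeff_sum f p"
  by (simp add: coeff_sum_def sum_negf)

lemma coeff_sum_diff: "coeff_sum f (p - r) = coeff_sum f p - coeff_sum f r"
  using coeff_sum_add[of f p "- r"] by (simp add: coeff_sum_minus)

lemma coeff_sum_sum: "coeff_sum f (\<Sum>x\<in>X. p x) = (\<Sum>x\<in>X. coeff_sum f (p x))"
  by (induction X rule: infinite_finite_induct) (simp_all add: coeff_sum_add)

lemma coeff_sum_monom: "coeff_sum f (monom a k) = a * f k"
proof -
  have "coeff_sum f (monom a k) = (\<Sum>i\<le>k. (if k = i then a else 0) * f i)"
    by (subst coeff_sum_eq[of _ k]) (auto simp: degree_monom_le)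
  also have "\<dots> = (\<Sum>i\<le>k. if i = k then a * f i else 0)" by (rule sum.cong) auto
  finally show ?thesis by simp
qed

text \<open>Both sides are additive in \<open>p\<close>, so agreement on monomials suffices.\<close>

lemma coeff_sum_eqI:
  assumes "\<And>a k. coeff_sum f (F (monom a k)) = coeff_sum g (H (monom a k))"
    and "\<And>p r. F (p + r) = F p + F r" "\<And>p r. H (p + r) = H p + H r"
    and "F 0 = 0" "H 0 = 0"
  shows "coeff_sum f (F p) = coeff_sum g (H p)"
proof -
  have F: "F (\<Sum>i\<in>X. r i) = (\<Sum>i\<in>X. F (r i))" for X :: "nat set" and r
    by (induction X rule: infinite_finite_induct) (simp_all add: assms)
  have H: "H (\<Sum>i\<in>X. r i) = (\<Sum>i\<in>X. H (r i))" for X :: "nat set" and r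
    by (induction X rule: infinite_finite_induct) (simp_all add: assms)
  have "coeff_sum f (F (\<Sum>i\<le>degree p. monom (coeff p i) i)) =
    coeff_sum g (H (\<Sum>i\<le>degree p. monom (coeff p i) i))"
    unfolding F H coeff_sum_sum assms(1) ..
  then show ?thesis unfolding poly_as_sum_of_monoms .
qed

lemma X_mult_pderiv_monom:
  "monom 1 1 * pderiv (monom a k) = monom (of_nat k * a :: 'b::field_char_0) k"
  by (cases k) (simp_all add: pderiv_monom mult_monom)

lemma coeff_sum_X_mult_pderiv:
  "coeff_sum f (monom 1 1 * pderiv p) = coeff_sum (\<lambda>k. of_nat k * f k) (p :: 'b::field_char_0 poly)"
  by (rule coeff_sum_eqI[where F = "\<lambda>p. monom 1 1 * pderiv p" and H = "\<lambda>p. p"])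
     (simp_all add: X_mult_pderiv_monom coeff_sum_monom pderiv_add distrib_left del: One_nat_def)

text \<open>On the values \<open>(q - k + 1) \<cdots> (q - k + m)\<close>, multiplication by \<open>q\<close> can be traded for
  differentiation of the coefficient polynomial, provided that it is divisible by \<open>1 - t\<close>.\<close>

lemma coeff_sum_pochhammer:
  fixes q :: "'b::field_char_0" and m :: nat
  defines "f \<equiv> \<lambda>k. pochhammer (q - of_nat k + 1) m"
  shows "q * coeff_sum f ((1 - monom 1 1) * r) =
    coeff_sum f (of_nat m * (monom 1 1 * r) + (1 - monom 1 1) * (monom 1 1 * pderiv r))"
proof -
  \<comment> \<open>Both \<open>f k\<close> and \<open>f (Suc k)\<close> extend to the same product
    of \<open>m + 1\<close> consecutive factors starting at \<open>q - k\<close>. The resulting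
    recurrence is the claim for \<open>r = t^k\<close>.\<close>
  have rel: "q * (f k - f (Suc k)) = of_nat m * f (Suc k) + of_nat k * (f k - f (Suc k))" for k
  proof -
    let ?x = "q - of_nat k"
    have "?x * pochhammer (?x + 1) m = pochhammer ?x m * (?x + of_nat m)"
      by (metis pochhammer_rec pochhammer_Suc)
    then show ?thesis unfolding f_def by (simp add: algebra_simps)
  qed
  have sm: "q * coeff_sum f p = coeff_sum f (smult q p)" for p
    by (simp add: coeff_sum_eq[of "smult q p" "degree p"] coeff_sum_def sum_distrib_left mult_ac degree_smult_le)
  show ?thesis
    unfolding sm
  proof (rule coeff_sum_eqI[where F = "\<lambda>r. smult q ((1 - monom 1 1) * r)" and
        H = "\<lambda>r. of_nat m * (monom 1 1 * r) + (1 - monom 1 1) * (monom 1 1 * pderiv r)"])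
    fix a k
    have "coeff_sum f (smult q ((1 - monom 1 1) * monom a k)) = a * (q * (f k - f (Suc k)))"
      unfolding sm[symmetric] 
      by (simp add: left_diff_distrib mult_monom coeff_sum_diff coeff_sum_monom algebra_simps)
    also have "\<dots> = coeff_sum f (of_nat m * (monom 1 1 * monom a k) + (1 - monom 1 1) * (monom 1 1 * pderiv (monom a k)))"
      unfolding X_mult_pderiv_monom rel
      by (simp add: left_diff_distrib mult_monom coeff_sum_diff coeff_sum_add coeff_sum_monom of_nat_poly smult_monom algebra_simps)
    finally show "coeff_sum f (smult q ((1 - monom 1 1) * monom a k)) =
      coeff_sum f (of_nat m * (monom 1 1 * monom a k) + (1 - monom 1 1) * (monom 1 1 * pderiv (monom a k)))" .
  qed (simp_all add: pderiv_add algebra_simps smult_add_right smult_diff_right)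
qed

subsection \<open>Products with all full cycles\<close>

text \<open>The condition of being a full cycle is replaced by \<open>full_cycle_indicator\<close>,
  and the sums are exchanged: for fixed \<open>S\<close>, the permutation \<open>u\<close> runs over
  the stabilizer of \<open>S\<close>.\<close>

lemma sum_full_cycles_coset_sum:
  fixes q :: "'b::field_char_0"
  assumes A: "finite A" "A \<noteq> {}"
  shows "of_nat (card A) * (\<Sum>u | u permutes A \<and> cycles_on u A = {A}. q ^ card (cycles_on (u \<circ> w) A)) =
    - (\<Sum>S\<in>Pow A. of_nat (card S) * (-1) ^ card S * coset_sum A S w q)"
proof -
  let ?Q = "\<lambda>u. q ^ card (cycles_on (u \<circ> w) A)"
  let ?e = "\<lambda>u S. (-1 :: 'b) ^ card (cycles_on u S)"
  have fin: "finite {u. u permutes A}" by (rule finite_permutations[OF A(1)])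
  have "of_nat (card A) * (\<Sum>u | u permutes A \<and> cycles_on u A = {A}. ?Q u) =
    (\<Sum>u\<in>{u. u permutes A} \<inter> {u. cycles_on u A = {A}}. of_nat (card A) * ?Q u)"
    by (simp add: sum_distrib_left Int_def)
  also have "\<dots> = (\<Sum>u | u permutes A. if cycles_on u A = {A} then of_nat (card A) * ?Q u else 0)"
    using sum.inter_restrict[OF fin, of "\<lambda>u. of_nat (card A) * ?Q u" "{u. cycles_on u A = {A}}"] by simp
  also have "\<dots> = (\<Sum>u | u permutes A. - (\<Sum>S | S \<in> Pow A \<and> u ` S = S. of_nat (card S) * ?e u S * ?Q u))"
  proof (rule sum.cong[OF refl])
    fix u assume "u \<in> {u. u permutes A}"
    then have u: "u permutes A" by simp
    have "(\<Sum>S | S \<in> Pow A \<and> u ` S = S. of_nat (card S) * ?e u S * ?Q u) =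
      (\<Sum>S | S \<subseteq> A \<and> u ` S = S. of_nat (card S) * ?e u S) * ?Q u"
      unfolding sum_distrib_right Pow_iff ..
    then show "(if cycles_on u A = {A} then of_nat (card A) * ?Q u else 0) =
      - (\<Sum>S | S \<in> Pow A \<and> u ` S = S. of_nat (card S) * ?e u S * ?Q u)"
      unfolding full_cycle_indicator[OF u A] by simp
  qed
  also have "\<dots> = - (\<Sum>u | u permutes A. \<Sum>S | S \<in> Pow A \<and> u ` S = S. of_nat (card S) * ?e u S * ?Q u)"
    by (rule sum_negf)
  also have "(\<Sum>u | u permutes A. \<Sum>S | S \<in> Pow A \<and> u ` S = S. of_nat (card S) * ?e u S * ?Q u) =
    (\<Sum>S\<in>Pow A. \<Sum>u | u \<in> {u. u permutes A} \<and> u ` S = S. of_nat (card S) * ?e u S * ?Q u)"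
    by (rule sum.swap_restrict) (use fin A in auto)
  also have "\<dots> = (\<Sum>S\<in>Pow A. of_nat (card S) * (-1) ^ card S * coset_sum A S w q)"
  proof (rule sum.cong[OF refl])
    fix S assume "S \<in> Pow A"
    then have S: "S \<subseteq> A" by simp
    have "{u \<in> {u. u permutes A}. u ` S = S} = set_stabilizer A S"
      by (simp add: set_stabilizer_def)
    then have "(\<Sum>u | u \<in> {u. u permutes A} \<and> u ` S = S. of_nat (card S) * ?e u S * ?Q u) =
      (\<Sum>u\<in>set_stabilizer A S. of_nat (card S) * (-1) ^ card S * (of_int (sign_on S u) * ?Q u))"
      by (intro sum.cong) (use sign_on_set_stabilizer[OF A(1) S, where 'b = 'b] in \<open>simp_all add: mult.assoc\<close>)
    then show "(\<Sum>u | u \<in> {u. u permutes A} \<and> u ` S = S. of_nat (card S) * ?e u S * ?Q u) =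
      of_nat (card S) * (-1) ^ card S * coset_sum A S w q"
      unfolding coset_sum_def sum_distrib_left .
  qed
  finally show ?thesis .
qed

text \<open>Summing \<open>coset_sum_eq\<close> over \<open>S\<close>, the first term collects the
  sets stable under \<open>w\<close>; the second, after exchanging the sums, collects the
  polynomials \<open>cut_gf\<close>.\<close>

lemma sum_coset_sum:
  fixes q :: "'b::field_char_0"
  assumes A: "finite A" and w: "w permutes A" and "q \<noteq> 0"
  defines "f \<equiv> \<lambda>k. of_nat k * pochhammer (q - of_nat k + 1) (card A - 1)"
  shows "(\<Sum>S\<in>Pow A. of_nat (card S) * (-1) ^ card S * coset_sum A S w q) =
    q * coeff_sum f (cycle_gf (cycles_on w A)) + coeff_sum f (\<Sum>c\<in>A. \<Sum>b\<in>A. cut_gf A w c b)"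
proof -
  let ?e = "\<lambda>u S. (-1 :: 'b) ^ card (cycles_on u S)"
  \<comment> \<open>Condition and summand of the double sum over \<open>S\<close> and pairs, with
    the pair as one variable as \<open>sum.swap_restrict\<close> requires.\<close>
  define R where "R S z \<longleftrightarrow> (case z of (c, b) \<Rightarrow> (transpose c b \<circ> w) ` S = S \<and> (c \<in> S \<and> b \<notin> S))" for S z
  define E where "E S z = (case z of (c, b) \<Rightarrow> ?e (transpose c b \<circ> w) S * f (card S))" for S z
  have fP: "finite (Pow A)" using A by simp
  have "(\<Sum>S\<in>Pow A. of_nat (card S) * (-1) ^ card S * coset_sum A S w q) =
    (\<Sum>S\<in>Pow A. q * (if w ` S = S then ?e w S * f (card S) else 0) +
      (\<Sum>z | z \<in> A \<times> A \<and> R S z. E S z))"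
  proof (rule sum.cong[OF refl])
    fix S assume "S \<in> Pow A"
    then have S: "S \<subseteq> A" by simp
    show "of_nat (card S) * (-1) ^ card S * coset_sum A S w q =
      q * (if w ` S = S then ?e w S * f (card S) else 0) + (\<Sum>z | z \<in> A \<times> A \<and> R S z. E S z)"
    proof (cases "S = {}")
      case True
      \<comment> \<open>\<open>coset_sum_eq\<close> excludes the empty set, whose contribution
        vanishes through the weight \<open>card S\<close>.\<close>
      have none: "{z \<in> A \<times> A. R {} z} = {}" by (auto simp: R_def)
      show ?thesis unfolding True none by (simp add: f_def)
    next
      case False
      let ?B = "pochhammer (q - of_nat (card S) + 1) (card A - 1)"
      let ?P = "{(c, b). c \<in> S \<and> b \<in> A - S \<and> (transpose c b \<circ> w) ` S = S}"
      have P: "{z \<in> A \<times> A. R S z} = ?P" using S by (auto simp: R_def)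
      have "of_nat (card S) * (-1) ^ card S * coset_sum A S w q =
        (if w ` S = S then of_nat (card S) * (-1) ^ card S * (of_int (sign_on S w) * (q * ?B)) else 0) +
        (\<Sum>(c, b)\<in>?P. of_nat (card S) * (-1) ^ card S * (of_int (sign_on S (transpose c b \<circ> w)) * ?B))"
        unfolding coset_sum_eq[OF A S w False assms(3)] distrib_left sum_distrib_left
        by (simp only: case_prod_beta' if_distrib[of "\<lambda>x. of_nat (card S) * (-1) ^ card S * x"] mult_zero_right)
      also have "(if w ` S = S then of_nat (card S) * (-1) ^ card S * (of_int (sign_on S w) * (q * ?B)) else 0) =
        q * (if w ` S = S then ?e w S * f (card S) else 0)"
        using sign_on_set_stabilizer[OF A S, of w, where 'b = 'b] w
        by (simp add: set_stabilizer_def f_def mult_ac)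
      also have "(\<Sum>(c, b)\<in>?P. of_nat (card S) * (-1) ^ card S * (of_int (sign_on S (transpose c b \<circ> w)) * ?B)) =
        (\<Sum>z | z \<in> A \<times> A \<and> R S z. E S z)"
        unfolding P
      proof (rule sum.cong[OF refl])
        fix z assume z: "z \<in> ?P"
        obtain c b where cb: "z = (c, b)" by (cases z)
        then have m: "c \<in> A" "b \<in> A" "(transpose c b \<circ> w) ` S = S" using z S by auto
        have "transpose c b \<circ> w \<in> set_stabilizer A S"
          using permutes_compose[OF w permutes_swap_id[OF m(1,2)]] m(3)
          by (simp only: set_stabilizer_def mem_Collect_eq simp_thms)
        from sign_on_set_stabilizer[OF A S this, where 'b = 'b]
        have "?e (transpose c b \<circ> w) S * f (card S) =
          of_nat (card S) * (-1) ^ card S * (of_int (sign_on S (transpose c b \<circ> w)) * ?B)"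
          unfolding f_def by (simp only: mult_ac)
        then show "(case z of (c, b) \<Rightarrow> of_nat (card S) * (-1) ^ card S * (of_int (sign_on S (transpose c b \<circ> w)) * ?B)) = E S z"
          unfolding cb E_def prod.case ..
      qed
      finally show ?thesis .
    qed
  qed
  also have "\<dots> = q * (\<Sum>S\<in>Pow A. if w ` S = S then ?e w S * f (card S) else 0) +
    (\<Sum>S\<in>Pow A. \<Sum>z | z \<in> A \<times> A \<and> R S z. E S z)"
    by (simp only: sum.distrib sum_distrib_left)
  also have "(\<Sum>S\<in>Pow A. if w ` S = S then ?e w S * f (card S) else 0) =
    (\<Sum>S | S \<subseteq> A \<and> w ` S = S. ?e w S * f (card S))"
    using sum.inter_filter[OF fP, of "\<lambda>S. ?e w S * f (card S)" "\<lambda>S. w ` S = S"] by simp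
  also have "\<dots> = coeff_sum f (\<Sum>S | S \<subseteq> A \<and> w ` S = S. monom (?e w S) (card S))"
    unfolding coeff_sum_sum coeff_sum_monom ..
  also have "\<dots> = coeff_sum f (cycle_gf (cycles_on w A))"
    unfolding sum_stable_sets_monom[OF w A] ..
  also have "(\<Sum>S\<in>Pow A. \<Sum>z | z \<in> A \<times> A \<and> R S z. E S z) = (\<Sum>z\<in>A \<times> A. \<Sum>S | S \<in> Pow A \<and> R S z. E S z)"
    by (rule sum.swap_restrict) (use A in auto)
  also have "\<dots> = (\<Sum>(c, b)\<in>A \<times> A. coeff_sum f (cut_gf A w c b))"
  proof (rule sum.cong[OF refl])
    fix z :: "'a \<times> 'a"
    obtain c b where cb: "z = (c, b)" by (cases z)
    show "(\<Sum>S | S \<in> Pow A \<and> R S z. E S z) = (case z of (c, b) \<Rightarrow> coeff_sum f (cut_gf A w c b))"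
      unfolding cb R_def E_def prod.case cut_gf_def coeff_sum_sum coeff_sum_monom Pow_iff ..
  qed
  also have "\<dots> = coeff_sum f (\<Sum>c\<in>A. \<Sum>b\<in>A. cut_gf A w c b)"
    unfolding coeff_sum_sum by (rule sum.cartesian_product[symmetric])
  finally show ?thesis .
qed

text \<open>Both generating functions are expressed through \<open>g\<close>, and trading
  \<open>q\<close> for differentiation cancels everything except one functional applied to
  \<open>g\<close>.\<close>

lemma sum_full_cycles:
  fixes q :: "'b::field_char_0"
  assumes A: "finite A" "A \<noteq> {}" and w: "w permutes A" and q: "q \<noteq> 0"
    and g: "(1 - monom 1 1) * g = cycle_gf (cycles_on w A)"
  shows "of_nat (card A) * (\<Sum>u | u permutes A \<and> cycles_on u A = {A}. q ^ card (cycles_on (u \<circ> w) A)) =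
    coeff_sum (\<lambda>k. pochhammer (q - of_nat k) (card A)) g"
proof -
  obtain m where m: "card A = Suc m" using A by (metis card_gt_0_iff gr0_implies_Suc)
  define f where "f k = pochhammer (q - of_nat k + 1) m" for k
  define X where "X = monom (1::'b) 1"
  \<comment> \<open>The Euler operator \<open>t d/dt\<close>, which multiplies the coefficient of
    \<open>t^k\<close> by \<open>k\<close> and so accounts for the weight
    \<open>card S\<close>.\<close>
  define theta where "theta p = X * pderiv p" for p
  let ?G = "cycle_gf (cycles_on w A) :: 'b poly"
  define H where "H = (\<Sum>c\<in>A. \<Sum>b\<in>A. cut_gf A w c b :: 'b poly)"
  have theta_add: "theta (p + r) = theta p + theta r" for p r
    by (simp add: theta_def pderiv_add algebra_simps)
  have theta_diff: "theta (p - r) = theta p - theta r" for p r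
    by (simp add: theta_def pderiv_diff algebra_simps)
  have theta_mult: "theta (p * r) = p * theta r + theta p * r" for p r
    by (simp add: theta_def pderiv_mult algebra_simps)
  have theta_X: "theta X = X" by (simp add: theta_def X_def pderiv_monom monom_0 one_pCons[symmetric])
  have theta_nat: "theta (of_nat j) = 0" for j
    by (induction j) (simp_all add: theta_def pderiv_add)
  have theta_1: "theta 1 = 0" by (simp add: theta_def)
  have G: "?G = (1 - X) * g" using g X_def by simp
  have tG: "pCons 0 (pderiv ?G) = theta ?G" by (simp add: theta_def X_def monom_altdef)
  have nz: "1 - X \<noteq> 0" 
  proof
    assume "1 - X = 0"
    then have "coeff (1 - X) 0 = 0" by simp
    then show False by (simp add: X_def)
  qed
  have "(1 - X) * H = (\<Sum>c\<in>A. (1 - X) * cycle_gf (cycles_on w A - {orbit w c}) - ?G)"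
    unfolding H_def X_def sum_distrib_left[where f = "\<lambda>c. \<Sum>b\<in>A. cut_gf A w c b"]
    by (rule sum.cong[OF refl]) (rule sum_cut_gf[OF w A(1)])
  also have "\<dots> = (1 - X) * (\<Sum>c\<in>A. cycle_gf (cycles_on w A - {orbit w c})) - of_nat (card A) * ?G"
    by (simp add: sum_subtractf sum_distrib_left)
  also have "(\<Sum>c\<in>A. cycle_gf (cycles_on w A - {orbit w c})) = of_nat (card A) * ?G - theta ?G"
    using pderiv_cycle_gf[OF w A(1), where 'b = 'b] unfolding tG by (simp add: algebra_simps)
  also have "(1 - X) * (of_nat (card A) * ?G - theta ?G) - of_nat (card A) * ?G =
    (1 - X) * (of_nat (card A) * ?G - theta ?G - of_nat (card A) * g)"
    unfolding G by (simp add: algebra_simps)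
  finally have H: "H = of_nat (card A) * ?G - theta ?G - of_nat (card A) * g"
    using nz by simp
  \<comment> \<open>Chosen so that \<open>coeff_sum_pochhammer\<close> at \<open>r\<close> equates
    \<open>q\<close> times the functional at \<open>g + theta ?G\<close> with the functional at
    \<open>theta g - theta H\<close>.\<close>
  define r where "r = g + theta g"
  have r1: "g + theta ?G = (1 - X) * r"
    unfolding G r_def by (simp add: theta_mult theta_diff theta_X theta_1 algebra_simps)
  have r2: "theta g - theta H = of_nat m * (X * r) + (1 - X) * theta r"
    unfolding H G r_def m
    by (simp add: theta_mult theta_diff theta_add theta_X theta_1 theta_nat algebra_simps)
  have fm: "(\<lambda>k. of_nat k * pochhammer (q - of_nat k + 1) (card A - 1)) = (\<lambda>k. of_nat k * f k)"
    by (simp add: f_def m)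
  have th: "coeff_sum (\<lambda>k. of_nat k * f k) p = coeff_sum f (theta p)" for p
    unfolding theta_def X_def by (rule coeff_sum_X_mult_pderiv[symmetric])
  have "of_nat (card A) * (\<Sum>u | u permutes A \<and> cycles_on u A = {A}. q ^ card (cycles_on (u \<circ> w) A)) =
    - (q * coeff_sum f (theta ?G) + coeff_sum f (theta H))"
    unfolding sum_full_cycles_coset_sum[OF A] sum_coset_sum[OF A(1) w q] fm th H_def[symmetric] ..
  also have "\<dots> = q * coeff_sum f g - coeff_sum f (theta g)"
  proof -
    have "q * coeff_sum f (g + theta ?G) = coeff_sum f (theta g - theta H)"
      unfolding r1 r2 using coeff_sum_pochhammer[of q m r] 
      unfolding f_def[abs_def, symmetric] theta_def X_def .
    then show ?thesis by (simp add: coeff_sum_add coeff_sum_diff algebra_simps)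
  qed
  also have "\<dots> = coeff_sum (\<lambda>k. (q - of_nat k) * f k) g"
    unfolding th[symmetric] by (simp add: coeff_sum_def sum_distrib_left sum_subtractf algebra_simps)
  also have "(\<lambda>k. (q - of_nat k) * f k) = (\<lambda>k. pochhammer (q - of_nat k) (card A))"
    unfolding f_def m pochhammer_rec ..
  finally show ?thesis .
qed

subsection \<open>Counting permutations by cycle type\<close>

text \<open>Stated for an arbitrary set, so that permutations can be counted by adjoining one point
  at a time.\<close>

definition cycle_type_on :: "'a set \<Rightarrow> ('a \<Rightarrow> 'a) \<Rightarrow> nat multiset" where
  "cycle_type_on A w = image_mset card (mset_set (cycles_on w A))"

section \<open>Recursion for \<open>z_partition\<close>\<close>

lemma prod_parts_superset:
  assumes "finite X" "set_mset lam \<subseteq> X"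
  shows "z_partition lam = (\<Prod>i\<in>X. i ^ count lam i * fact (count lam i))"
  unfolding z_partition_def
  by (rule prod.mono_neutral_left) (use assms in \<open>auto simp: not_in_iff\<close>)

lemma z_partition_add_mset:
  "z_partition (add_mset i lam) = i * Suc (count lam i) * z_partition lam"
proof -
  let ?X = "insert i (set_mset lam)"
  have "z_partition (add_mset i lam) = (\<Prod>j\<in>?X. j ^ count (add_mset i lam) j * fact (count (add_mset i lam) j))"
    by (rule prod_parts_superset) auto
  also have "\<dots> = (i ^ Suc (count lam i) * fact (Suc (count lam i))) *
      (\<Prod>j\<in>?X - {i}. j ^ count (add_mset i lam) j * fact (count (add_mset i lam) j))"
    by (subst prod.remove[of _ i]) simp_all
  also have "(\<Prod>j\<in>?X - {i}. j ^ count (add_mset i lam) j * fact (count (add_mset i lam) j)) =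
      (\<Prod>j\<in>?X - {i}. j ^ count lam j * fact (count lam j))"
    by (rule prod.cong) auto
  also have "(i ^ Suc (count lam i) * fact (Suc (count lam i))) * (\<Prod>j\<in>?X - {i}. j ^ count lam j * fact (count lam j)) =
      i * Suc (count lam i) * (\<Prod>j\<in>?X. j ^ count lam j * fact (count lam j))"
    by (subst (2) prod.remove[of _ i]) (simp_all add: algebra_simps)
  also have "(\<Prod>j\<in>?X. j ^ count lam j * fact (count lam j)) = z_partition lam"
    by (rule prod_parts_superset[symmetric]) auto
  finally show ?thesis .
qed

lemma z_partition_remove:
  assumes "i \<in># lam"
  shows "z_partition lam = i * count lam i * z_partition (lam - {#i#})"
proof -
  have "lam = add_mset i (lam - {#i#})" using assms by simp
  then have "z_partition lam = i * Suc (count (lam - {#i#}) i) * z_partition (lam - {#i#})"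
    using z_partition_add_mset by metis
  moreover have "Suc (count (lam - {#i#}) i) = count lam i" using assms by simp
  ultimately show ?thesis by (simp only:)
qed

lemma z_partition_pos:
  assumes "0 \<notin># lam"
  shows "z_partition lam > 0"
  unfolding z_partition_def
proof (rule prod_pos)
  fix i assume "i \<in># lam"
  then have "i > 0" using assms by (cases i) auto
  then show "0 < i ^ count lam i * fact (count lam i)" by simp
qed

lemma sum_mset_eq_sum_count:
  assumes "finite X" "set_mset (M :: nat multiset) \<subseteq> X"
  shows "(\<Sum>i\<in>X. i * count M i) = sum_mset M"
  using assms(2)
proof (induction M)
  case (add x M)
  have "(\<Sum>i\<in>X. i * count (add_mset x M) i) = (\<Sum>i\<in>X. i * count M i + (if i = x then i else 0))"
    by (rule sum.cong) auto
  also have "\<dots> = sum_mset M + x" using add assms(1) by (simp add: sum.distrib)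
  finally show ?case by simp
qed simp

section \<open>Cycle types after adjoining a point\<close>

lemma cycle_type_on_insert_fixed:
  assumes "p permutes F" "finite F" "x \<notin> F"
  shows "cycle_type_on (insert x F) p = add_mset 1 (cycle_type_on F p)"
  unfolding cycle_type_on_def using cycles_on_insert_fixed[OF assms(1,3)] assms(2) by simp

lemma cycle_type_on_insert_transpose:
  assumes "p permutes F" "finite F" "x \<notin> F" "b \<in> F"
  shows "cycle_type_on (insert x F) (transpose x b \<circ> p) =
    add_mset (Suc (card (orbit p b))) (cycle_type_on F p - {#card (orbit p b)#})"
proof -
  have b: "orbit p b \<in> cycles_on p F" using assms(4) by simp
  have sub: "orbit p b \<subseteq> F" using cycles_on_subset[OF assms(1) b] .
  then have c: "card (insert x (orbit p b)) = Suc (card (orbit p b))"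
    using assms(2,3) finite_subset[OF sub] by (subst card_insert_disjoint) auto
  have "image_mset card (mset_set (cycles_on p F - {orbit p b})) =
    image_mset card (mset_set (cycles_on p F)) - {#card (orbit p b)#}"
    using assms(2) b by (simp add: mset_set_Diff image_mset_Diff)
  then show ?thesis
    unfolding cycle_type_on_def cycles_on_insert_transpose[OF assms]
    using assms(2) insert_orbit_notin_cycles_on[OF assms(1,3)] c by simp
qed

lemma count_cycle_type_on:
  assumes "p permutes F" "finite F"
  shows "card {b \<in> F. card (orbit p b) = m} = m * count (cycle_type_on F p) m"
proof -
  let ?X = "cycles_on p F"
  \<comment> \<open>\<open>sum_orbits\<close> is stated over rings, so the count passes through
    \<open>int\<close>.\<close>
  have "int (card {b \<in> F. card (orbit p b) = m}) = (\<Sum>b\<in>F. if card (orbit p b) = m then 1 else 0)"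
    using sum.inter_filter[OF assms(2), of "\<lambda>_. 1::int" "\<lambda>b. card (orbit p b) = m"] by simp
  also have "\<dots> = (\<Sum>C\<in>?X. of_nat (card C) * (if card C = m then 1 else 0))"
    by (rule sum_orbits[OF assms, of "\<lambda>C. if card C = m then 1 else 0"])
  also have "\<dots> = (\<Sum>C\<in>?X. if card C = m then int m else 0)" by (rule sum.cong) auto
  also have "\<dots> = int m * int (card {C \<in> ?X. card C = m})"
    using sum.inter_filter[of ?X "\<lambda>_. int m" "\<lambda>C. card C = m"] assms(2) by (simp add: mult.commute)
  also have "card {C \<in> ?X. card C = m} = count (cycle_type_on F p) m"
    unfolding cycle_type_on_def using assms(2)
    by (simp add: count_image_mset vimage_def Int_def conj_commute)
  finally show ?thesis by (simp flip: of_nat_mult)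
qed

text \<open>Each permutation of \<open>insert x F\<close> is \<open>transpose x b \<circ> w\<close>
  with \<open>w\<close> permuting \<open>F\<close>. For \<open>b = x\<close> a part \<open>1\<close>
  is added. For \<open>b\<close> in a cycle of length \<open>i - 1\<close> that part grows to
  \<open>i\<close>, so \<open>w\<close> has the type with \<open>i\<close> lowered by one, and the
  number of such \<open>b\<close> is \<open>i - 1\<close> times the multiplicity of
  \<open>i - 1\<close> in it.\<close>

lemma card_cycle_type_on_insert:
  assumes F: "finite F" "x \<notin> F"
  shows "card {w. w permutes insert x F \<and> cycle_type_on (insert x F) w = lam} =
    (if 1 \<in># lam then card {w. w permutes F \<and> cycle_type_on F w = lam - {#1#}} else 0) +
    (\<Sum>i\<in>set_mset lam - {1}. (i - 1) * count (add_mset (i - 1) (lam - {#i#})) (i - 1) *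
       card {w. w permutes F \<and> cycle_type_on F w = add_mset (i - 1) (lam - {#i#})})"
proof -
  let ?mu = "\<lambda>i. add_mset (i - 1) (lam - {#i#})"
  have ind: "card {w. w permutes B \<and> cycle_type_on B w = nu} =
    (\<Sum>w | w permutes B. if cycle_type_on B w = nu then 1 else 0)" if "finite B" for B :: "'a set" and nu
    using sum.inter_filter[OF finite_permutations[OF that], of "\<lambda>_. 1::nat" "\<lambda>w. cycle_type_on B w = nu"] by simp
  have "card {w. w permutes insert x F \<and> cycle_type_on (insert x F) w = lam} =
    (\<Sum>b\<in>insert x F. \<Sum>w | w permutes F. if cycle_type_on (insert x F) (transpose x b \<circ> w) = lam then 1 else 0)"
    unfolding ind[OF finite.insertI[OF F(1)]] by (rule sum_over_permutations_insert[OF F])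
  also have "\<dots> = (\<Sum>w | w permutes F. if cycle_type_on (insert x F) w = lam then 1 else 0) +
    (\<Sum>b\<in>F. \<Sum>w | w permutes F. if cycle_type_on (insert x F) (transpose x b \<circ> w) = lam then 1 else 0)"
    using F by simp
  also have "(\<Sum>w | w permutes F. if cycle_type_on (insert x F) w = lam then 1 else 0) =
    (if 1 \<in># lam then card {w. w permutes F \<and> cycle_type_on F w = lam - {#1#}} else 0)"
  proof -
    have "(\<Sum>w | w permutes F. if cycle_type_on (insert x F) w = lam then 1 else 0) =
      (\<Sum>w | w permutes F. if 1 \<in># lam \<and> cycle_type_on F w = lam - {#1#} then 1 else (0::nat))"
    proof (rule sum.cong[OF refl])
      fix w assume "w \<in> {w. w permutes F}"
      then have "cycle_type_on (insert x F) w = add_mset 1 (cycle_type_on F w)"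
        using cycle_type_on_insert_fixed[OF _ F] by simp
      then have "cycle_type_on (insert x F) w = lam \<longleftrightarrow> 1 \<in># lam \<and> cycle_type_on F w = lam - {#1#}"
        by auto
      then show "(if cycle_type_on (insert x F) w = lam then 1 else 0) =
        (if 1 \<in># lam \<and> cycle_type_on F w = lam - {#1#} then 1 else (0::nat))" by simp
    qed
    then show ?thesis unfolding ind[OF F(1)] by simp
  qed
  also have "(\<Sum>b\<in>F. \<Sum>w | w permutes F. if cycle_type_on (insert x F) (transpose x b \<circ> w) = lam then 1 else 0) =
    (\<Sum>w | w permutes F. \<Sum>b\<in>F. \<Sum>i\<in>set_mset lam - {1}. if cycle_type_on F w = ?mu i then if card (orbit w b) = i - 1 then 1 else (0::nat) else 0)"
  proof (subst sum.swap, intro sum.cong refl)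
    fix w b assume "w \<in> {w. w permutes F}" and b: "b \<in> F"
    then have w: "w permutes F" by simp
    let ?m = "card (orbit w b)"
    have orb: "orbit w b \<in> cycles_on w F" using b by simp
    \<comment> \<open>Positivity makes \<open>?m = i - 1\<close> equivalent to
      \<open>i = Suc ?m\<close> despite truncated subtraction, and makes \<open>Suc ?m\<close>
      different from \<open>1\<close>.\<close>
    have m: "?m > 0"
      using orbit_nonempty[of w b] finite_subset[OF cycles_on_subset[OF w orb] F(1)] by (simp add: card_gt_0_iff)
    have mem: "?m \<in># cycle_type_on F w" unfolding cycle_type_on_def using orb F(1) by auto
    have iff: "cycle_type_on (insert x F) (transpose x b \<circ> w) = lam \<longleftrightarrow>
      Suc ?m \<in># lam \<and> cycle_type_on F w = ?mu (Suc ?m)"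
      unfolding cycle_type_on_insert_transpose[OF w F b] using mem
      by (auto simp: add_mset_remove_trivial_eq)
    have "(\<Sum>i\<in>set_mset lam - {1}. if cycle_type_on F w = ?mu i then if ?m = i - 1 then 1 else (0::nat) else 0) =
      (\<Sum>i\<in>set_mset lam - {1}. if i = Suc ?m then if cycle_type_on F w = ?mu (Suc ?m) then 1 else 0 else 0)"
      by (rule sum.cong) (use m in auto)
    also have "\<dots> = (if cycle_type_on (insert x F) (transpose x b \<circ> w) = lam then 1 else 0)"
      unfolding iff using m by simp
    finally show "(if cycle_type_on (insert x F) (transpose x b \<circ> w) = lam then 1 else 0) =
      (\<Sum>i\<in>set_mset lam - {1}. if cycle_type_on F w = ?mu i then if ?m = i - 1 then 1 else (0::nat) else 0)" ..
  qed
  also have "\<dots> = (\<Sum>w | w permutes F. \<Sum>i\<in>set_mset lam - {1}.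
      if cycle_type_on F w = ?mu i then (i - 1) * count (?mu i) (i - 1) else 0)"
  proof (rule sum.cong[OF refl])
    fix w assume "w \<in> {w. w permutes F}"
    then have w: "w permutes F" by simp
    show "(\<Sum>b\<in>F. \<Sum>i\<in>set_mset lam - {1}. if cycle_type_on F w = ?mu i then if card (orbit w b) = i - 1 then 1 else (0::nat) else 0) =
      (\<Sum>i\<in>set_mset lam - {1}. if cycle_type_on F w = ?mu i then (i - 1) * count (?mu i) (i - 1) else 0)"
    proof (subst sum.swap, rule sum.cong[OF refl])
      fix i
      have "(\<Sum>b\<in>F. if card (orbit w b) = i - 1 then 1 else (0::nat)) = card {b \<in> F. card (orbit w b) = i - 1}"
        using sum.inter_filter[OF F(1), of "\<lambda>_. 1::nat" "\<lambda>b. card (orbit w b) = i - 1"] by simp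
      then show "(\<Sum>b\<in>F. if cycle_type_on F w = ?mu i then if card (orbit w b) = i - 1 then 1 else (0::nat) else 0) =
        (if cycle_type_on F w = ?mu i then (i - 1) * count (?mu i) (i - 1) else 0)"
        unfolding count_cycle_type_on[OF w F(1)] by simp
    qed
  qed
  also have "\<dots> = (\<Sum>i\<in>set_mset lam - {1}. (i - 1) * count (?mu i) (i - 1) *
       card {w. w permutes F \<and> cycle_type_on F w = ?mu i})"
    unfolding ind[OF F(1)] sum_distrib_left
    by (subst sum.swap, intro sum.cong refl) simp
  finally show ?thesis .
qed

text \<open>In the recursion, multiplied by \<open>z_partition lam\<close>, the part size
  \<open>i\<close> contributes \<open>fact (card F) * (i * count lam i)\<close>, and the numbers
  \<open>i * count lam i\<close> add up to \<open>Suc (card F)\<close>.\<close>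

lemma card_cycle_type_on:
  assumes "finite A" "0 \<notin># lam" "sum_mset lam = card A"
  shows "card {w. w permutes A \<and> cycle_type_on A w = lam} * z_partition lam = fact (card A)"
  using assms
proof (induction A arbitrary: lam rule: finite_induct)
  case empty
  then have "lam = {#}" by (metis card.empty multiset_nonemptyE sum_mset_0_iff)
  moreover have "{w. w permutes ({} :: 'a set) \<and> cycle_type_on {} w = {#}} = {id}"
    by (auto simp: cycle_type_on_def)
  ultimately show ?case by (simp add: z_partition_def)
next
  case (insert x F)
  let ?mu = "\<lambda>i. add_mset (i - 1) (lam - {#i#})"
  let ?N = "\<lambda>nu. card {w. w permutes F \<and> cycle_type_on F w = nu}"
  have size: "sum_mset lam = Suc (card F)" using insert by simp
  have 1: "(if 1 \<in># lam then ?N (lam - {#1#}) else 0) * z_partition lam = fact (card F) * count lam 1"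
  proof (cases "1 \<in># lam")
    case True
    then have "sum_mset lam = 1 + sum_mset (lam - {#1#})" by (metis insert_DiffM sum_mset.add_mset)
    then have "?N (lam - {#1#}) * z_partition (lam - {#1#}) = fact (card F)"
      using insert.prems(1) size by (intro insert.IH) (auto dest: in_diffD)
    then show ?thesis using True z_partition_remove[OF True] by (simp add: mult_ac)
  next
    case False
    then have "count lam 1 = 0" by (simp only: not_in_iff)
    then show ?thesis using False by (simp only: if_False mult_0 mult_0_right)
  qed
  have 2: "(i - 1) * count (?mu i) (i - 1) * ?N (?mu i) * z_partition lam = fact (card F) * (i * count lam i)"
    if i: "i \<in> set_mset lam - {1}" for i
  proof -
    have i0: "i > 1" using i insert.prems(1) by (cases i) auto
    have "sum_mset lam = i + sum_mset (lam - {#i#})" using i by (metis DiffD1 insert_DiffM sum_mset.add_mset)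
    then have IH: "?N (?mu i) * z_partition (?mu i) = fact (card F)"
      using insert.prems(1) size i0 by (intro insert.IH) (auto dest: in_diffD)
    \<comment> \<open>Both values of \<open>z_partition\<close> are compared through
      \<open>lam - {#i#}\<close>, which exchanges the factor from the recursion for
      \<open>i * count lam i\<close>.\<close>
    have "z_partition (?mu i) = (i - 1) * count (?mu i) (i - 1) * z_partition (lam - {#i#})"
      using z_partition_remove[of "i - 1" "?mu i"] by simp
    moreover have "z_partition lam = i * count lam i * z_partition (lam - {#i#})"
      using i by (intro z_partition_remove) auto
    ultimately have "(i - 1) * count (?mu i) (i - 1) * ?N (?mu i) * z_partition lam =
      (?N (?mu i) * z_partition (?mu i)) * (i * count lam i)" by (simp only: mult_ac)
    then show ?thesis unfolding IH .
  qed
  have "card {w. w permutes insert x F \<and> cycle_type_on (insert x F) w = lam} * z_partition lam =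
    fact (card F) * count lam 1 + (\<Sum>i\<in>set_mset lam - {1}. fact (card F) * (i * count lam i))"
    unfolding card_cycle_type_on_insert[OF insert.hyps] distrib_right 1 sum_distrib_right
    by (rule arg_cong[where f = "\<lambda>y. _ + y"]) (rule sum.cong[OF refl 2])
  also have "\<dots> = fact (card F) * (1 * count lam 1 + (\<Sum>i\<in>set_mset lam - {1}. i * count lam i))"
    by (simp add: sum_distrib_left distrib_left)
  also have "1 * count lam 1 + (\<Sum>i\<in>set_mset lam - {1}. i * count lam i) = (\<Sum>i\<in>insert 1 (set_mset lam). i * count lam i)"
    by (subst (2) sum.remove[of _ 1]) simp_all
  also have "\<dots> = Suc (card F)" using sum_mset_eq_sum_count[of "insert 1 (set_mset lam)" lam] size by auto
  finally show ?case using insert.hyps by simp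
qed

subsection \<open>Passage to a fixed full cycle\<close>

lemma cycle_type_on_conj:
  assumes "w permutes A" "finite A" "s permutes A"
  shows "cycle_type_on A (s \<circ> w \<circ> inv s) = cycle_type_on A w"
proof -
  have inj: "inj s" using permutes_inj[OF assms(3)] .
  then have "inj_on (image s) (cycles_on w A)" by (meson inj_image_eq_iff inj_onI)
  then have "cycle_type_on A (s \<circ> w \<circ> inv s) = image_mset (card \<circ> image s) (mset_set (cycles_on w A))"
    unfolding cycle_type_on_def cycles_on_conj[OF assms]
    by (simp add: image_mset_mset_set[symmetric] image_mset.compositionality)
  also have "card \<circ> image s = card"
    using card_image[OF inj_on_subset[OF inj subset_UNIV]] by (simp add: fun_eq_iff)
  finally show ?thesis unfolding cycle_type_on_def .
qed

section \<open>Conjugacy of full cycles\<close>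

lemma full_cycle_enumeration:
  assumes "c permutes A" "finite A" "cycles_on c A = {A}" "a \<in> A"
  shows "bij_betw (\<lambda>i. (c ^^ i) a) {..<card A} A" and "(c ^^ card A) a = a"
proof -
  have A: "orbit c a = A" using assms(3,4) by blast
  have self: "a \<in> orbit c a" using A assms(4) by simp
  have inj: "inj_on (\<lambda>n. (c ^^ n) a) {0..<funpow_dist1 c a a}" by (rule inj_on_funpow_dist1[OF self])
  have orb: "A = (\<lambda>n. (c ^^ n) a) ` {0..<funpow_dist1 c a a}"
    using orbit_conv_funpow_dist1[OF self] unfolding A .
  have N: "card A = funpow_dist1 c a a" using card_image[OF inj] unfolding orb[symmetric] by simp
  show "bij_betw (\<lambda>i. (c ^^ i) a) {..<card A} A"
    unfolding bij_betw_def N lessThan_atLeast0 using inj orb by blast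
  show "(c ^^ card A) a = a" unfolding N by (rule funpow_dist1_prop[OF self])
qed

text \<open>The conjugating permutation sends \<open>(c ^^ i) a\<close> to \<open>(d ^^ i) a\<close>
  and fixes all points outside \<open>A\<close>.\<close>

lemma full_cycles_conjugate:
  assumes A: "finite A" "A \<noteq> {}"
    and c: "c permutes A" "cycles_on c A = {A}" and d: "d permutes A" "cycles_on d A = {A}"
  obtains s where "s permutes A" "d = s \<circ> c \<circ> inv s"
proof -
  obtain a where a: "a \<in> A" using A by auto
  note ec = full_cycle_enumeration[OF c(1) A(1) c(2) a]
  note ed = full_cycle_enumeration[OF d(1) A(1) d(2) a]
  let ?I = "{..<card A}"
  define h where "h = (\<lambda>i. (d ^^ i) a) \<circ> inv_into ?I (\<lambda>i. (c ^^ i) a)"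
  have "bij_betw h A A"
    unfolding h_def by (rule bij_betw_trans[OF bij_betw_inv_into[OF ec(1)] ed(1)])
  then have s: "restrict_id h A permutes A" by (rule permutes_restrict_id)
  define s where "s = restrict_id h A"
  have sc: "s ((c ^^ i) a) = (d ^^ i) a" if "i < card A" for i
  proof -
    have "(c ^^ i) a \<in> A" using ec(1) that by (auto simp: bij_betw_def)
    moreover have "inv_into ?I (\<lambda>i. (c ^^ i) a) ((c ^^ i) a) = i"
      by (rule inv_into_f_f) (use ec(1) that in \<open>auto simp: bij_betw_def\<close>)
    ultimately show ?thesis by (simp add: s_def h_def)
  qed
  have A0: "card A > 0" using A by (simp add: card_gt_0_iff)
  have comm: "s (c x) = d (s x)" for x
  proof (cases "x \<in> A")
    case True
    then obtain i where i: "i < card A" "x = (c ^^ i) a" using ec(1) by (auto simp: bij_betw_def)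
    show ?thesis
    proof (cases "Suc i < card A")
      case True
      then show ?thesis using sc[of "Suc i"] sc[of i] i by simp
    next
      \<comment> \<open>At the last index both cycles wrap around to \<open>a\<close>.\<close>
      case False
      then have "card A = Suc i" using i by simp
      then have "c x = a" "d (s x) = a" using ec(2) ed(2) sc[of i] i by simp_all
      then show ?thesis using sc[of 0] A0 by simp
    qed
  next
    case False
    then show ?thesis
      using permutes_not_in[OF c(1)] permutes_not_in[OF d(1)] by (simp add: s_def)
  qed
  have "d = s \<circ> c \<circ> inv s"
  proof
    fix y
    have "(s \<circ> c \<circ> inv s) y = d (s (inv s y))" by (simp add: comm)
    then show "d y = (s \<circ> c \<circ> inv s) y" using s by (simp add: s_def permutes_inverses)
  qed
  then show thesis using that s unfolding s_def by blast
qed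

text \<open>Replacing \<open>w\<close> by its conjugate under \<open>inv s\<close> preserves the
  cycle type, and the product with the conjugated \<open>c\<close> is conjugate to the product of
  \<open>c\<close> with the new \<open>w\<close>.\<close>

lemma sum_cycle_type_conj:
  fixes q :: "'b::comm_ring_1"
  assumes A: "finite A" and c: "c permutes A" and s: "s permutes A"
  shows "(\<Sum>w | w permutes A \<and> cycle_type_on A w = lam. q ^ card (cycles_on ((s \<circ> c \<circ> inv s) \<circ> w) A)) =
    (\<Sum>w | w permutes A \<and> cycle_type_on A w = lam. q ^ card (cycles_on (c \<circ> w) A))"
proof (rule sum.reindex_bij_witness[of _ "\<lambda>w. s \<circ> w \<circ> inv s" "\<lambda>w. inv s \<circ> w \<circ> s"])
  note si = permutes_inv[OF s] and sii = permutes_inv_inv[OF s]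
  have T: "r \<circ> w \<circ> inv r \<in> {w. w permutes A \<and> cycle_type_on A w = lam}"
    if "r permutes A" "w \<in> {w. w permutes A \<and> cycle_type_on A w = lam}" for r w
    using that cycle_type_on_conj[OF _ A that(1), of w]
    by (simp add: permutes_compose permutes_inv)
  fix w assume w: "w \<in> {w. w permutes A \<and> cycle_type_on A w = lam}"
  show "s \<circ> (inv s \<circ> w \<circ> s) \<circ> inv s = w" "inv s \<circ> (s \<circ> w \<circ> inv s) \<circ> s = w"
    using s by (simp_all add: fun_eq_iff permutes_inverses)
  show "inv s \<circ> w \<circ> s \<in> {w. w permutes A \<and> cycle_type_on A w = lam}"
    using T[OF si w] unfolding sii .
  show "s \<circ> w \<circ> inv s \<in> {w. w permutes A \<and> cycle_type_on A w = lam}"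
    using T[OF s w] .
  have cw: "c \<circ> (inv s \<circ> w \<circ> s) permutes A"
    using w c s si by (auto intro!: permutes_compose)
  have "(s \<circ> c \<circ> inv s) \<circ> w = s \<circ> (c \<circ> (inv s \<circ> w \<circ> s)) \<circ> inv s"
    using s by (simp add: fun_eq_iff permutes_inverses)
  then show "q ^ card (cycles_on (c \<circ> (inv s \<circ> w \<circ> s)) A) = q ^ card (cycles_on ((s \<circ> c \<circ> inv s) \<circ> w) A)"
    using card_cycles_on_conj[OF cw A s] by (simp only:)
qed

lemma cycle_type_on_full_iff:
  assumes "w permutes A" "finite A"
  shows "cycle_type_on A w = {#card A#} \<longleftrightarrow> cycles_on w A = {A}"
proof
  assume t: "cycle_type_on A w = {#card A#}"
  have "size (cycle_type_on A w) = card (cycles_on w A)" by (simp add: cycle_type_on_def)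
  then have "card (cycles_on w A) = 1" unfolding t by simp
  then obtain C where C: "cycles_on w A = {C}" by (auto simp: card_1_singleton_iff)
  moreover have "\<Union>(cycles_on w A) = A"
    by (rule Union_cycles_on[OF assms subset_refl permutes_image[OF assms(1)]])
  ultimately show "cycles_on w A = {A}" by simp
next
  assume "cycles_on w A = {A}"
  then show "cycle_type_on A w = {#card A#}" by (simp add: cycle_type_on_def)
qed

lemma cycle_gf_eq_prod_mset:
  "cycle_gf (cycles_on w A) = (\<Prod>k\<in>#cycle_type_on A w. 1 - monom 1 k)"
  by (simp add: cycle_gf_def cycle_type_on_def prod_unfold_prod_mset image_mset.compositionality o_def)

text \<open>Double counting over pairs of a full cycle and a permutation of type \<open>lam\<close>:
  every full cycle contributes the same sum over \<open>w\<close>, and every \<open>w\<close>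
  contributes the value from \<open>sum_full_cycles\<close>.\<close>

lemma sum_cycle_type_full_cycle:
  fixes q :: "'b::field_char_0"
  assumes A: "finite A" "A \<noteq> {}" and c: "c permutes A" "cycles_on c A = {A}"
    and lam: "0 \<notin># lam" "sum_mset lam = card A" and q: "q \<noteq> 0"
  shows "of_nat (z_partition lam) * (\<Sum>w | w permutes A \<and> cycle_type_on A w = lam. q ^ card (cycles_on (c \<circ> w) A)) =
    coeff_sum (\<lambda>k. pochhammer (q - of_nat k) (card A)) (g_poly lam)"
proof -
  let ?n = "card A"
  let ?T = "{w. w permutes A \<and> cycle_type_on A w = lam}"
  let ?U = "{u. u permutes A \<and> cycles_on u A = {A}}"
  let ?Phi = "coeff_sum (\<lambda>k. pochhammer (q - of_nat k) ?n) (g_poly lam)"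
  let ?P = "\<Sum>w\<in>?T. q ^ card (cycles_on (c \<circ> w) A)"
  have n0: "?n > 0" using A by (simp add: card_gt_0_iff)
  have lam0: "lam \<noteq> {#}" using lam(2) n0 by auto
  have T: "card ?T * z_partition lam = fact ?n" by (rule card_cycle_type_on[OF A(1) lam])
  \<comment> \<open>Full cycles are the permutations with the single part \<open>card A\<close>, for
    which \<open>z_partition\<close> is \<open>card A\<close>.\<close>
  have "?U = {w. w permutes A \<and> cycle_type_on A w = {#?n#}}"
    using cycle_type_on_full_iff[OF _ A(1)] by blast
  then have U: "card ?U * ?n = fact ?n"
    using card_cycle_type_on[OF A(1), of "{#?n#}"] n0 by (simp add: z_partition_def)
  have "(\<Sum>u\<in>?U. \<Sum>w\<in>?T. q ^ card (cycles_on (u \<circ> w) A)) = (\<Sum>u\<in>?U. ?P)"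
  proof (rule sum.cong[OF refl])
    fix u assume "u \<in> ?U"
    then have u: "u permutes A" "cycles_on u A = {A}" by auto
    from full_cycles_conjugate[OF A c u] obtain s where s: "s permutes A" "u = s \<circ> c \<circ> inv s" .
    show "(\<Sum>w\<in>?T. q ^ card (cycles_on (u \<circ> w) A)) = ?P"
      unfolding s(2) by (rule sum_cycle_type_conj[OF A(1) c(1) s(1)])
  qed
  then have "of_nat (card ?U) * ?P = (\<Sum>w\<in>?T. \<Sum>u\<in>?U. q ^ card (cycles_on (u \<circ> w) A))"
    by (subst sum.swap) simp
  then have "of_nat ?n * (of_nat (card ?U) * ?P) = (\<Sum>w\<in>?T. of_nat ?n * (\<Sum>u\<in>?U. q ^ card (cycles_on (u \<circ> w) A)))"
    by (simp add: sum_distrib_left)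
  also have "\<dots> = (\<Sum>w\<in>?T. ?Phi)"
  proof (rule sum.cong[OF refl])
    fix w assume "w \<in> ?T"
    then have w: "w permutes A" "cycle_type_on A w = lam" by auto
    show "of_nat ?n * (\<Sum>u\<in>?U. q ^ card (cycles_on (u \<circ> w) A)) = ?Phi"
      by (rule sum_full_cycles[OF A w(1) q])
         (simp only: g_poly_exact[OF lam0] cycle_gf_eq_prod_mset w(2))
  qed
  finally have "of_nat (card ?U * ?n) * ?P = of_nat (card ?T) * ?Phi" by (simp add: mult_ac)
  then have "of_nat (z_partition lam) * (of_nat (fact ?n) * ?P) = of_nat (z_partition lam) * (of_nat (card ?T) * ?Phi)"
    unfolding U by simp
  then have "of_nat (fact ?n) * (of_nat (z_partition lam) * ?P) = of_nat (card ?T * z_partition lam) * ?Phi"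
    by (simp add: mult_ac)
  then have "of_nat (fact ?n) * (of_nat (z_partition lam) * ?P) = of_nat (fact ?n) * ?Phi" unfolding T .
  then show ?thesis by simp
qed

section \<open>The standard cycle and the polynomial identity\<close>

lemma cycles_on_long_cycle:
  assumes "n \<ge> 1"
  shows "cycles_on (long_cycle n) {1..n} = {{1..n}}"
proof -
  let ?c = "long_cycle n"
  have c: "?c permutes {1..n}" by (rule long_cycle_permutes)
  have self: "x \<in> orbit ?c x" for x by (rule permutes_self_in_orbit[OF c]) simp
  have "i \<in> orbit ?c 1" if "1 \<le> i" "i \<le> n" for i
    using that
  proof (induction i rule: dec_induct)
    case base
    show ?case by (rule self)
  next
    case (step i)
    then have "?c i = Suc i" using long_cycle_eq[of i n] by simp
    then show ?case using step orbit.step[of i ?c 1] by simp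
  qed
  then have "{1..n} \<subseteq> orbit ?c 1" by (auto simp del: One_nat_def)
  moreover have "orbit ?c 1 \<subseteq> {1..n}" by (rule permutes_orbit_subset[OF c]) (use assms in simp)
  ultimately have orb1: "orbit ?c 1 = {1..n}" by (rule equalityI[rotated])
  have "orbit ?c x = {1..n}" if "x \<in> {1..n}" for x
    using permutes_orbit_eq[OF c, of x 1] that unfolding orb1 by simp
  then have "cycles_on ?c {1..n} = (\<lambda>_. {1..n}) ` {1..n}" by (rule image_cong[OF refl])
  then show ?thesis using assms by (simp add: image_constant_conv)
qed

lemma poly_backward_shift_funpow: "poly ((backward_shift ^^ k) f) x = poly f (x - of_nat k)"
  by (induction k arbitrary: x) (simp_all add: poly_backward_shift algebra_simps)

text \<open>Read backwards, the factors of the falling factorial from \<open>x + n - 1\<close> are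
  those of the rising factorial from \<open>x\<close>.\<close>

lemma poly_falling_factorial:
  "poly (falling_factorial (monom 1 1 + of_nat n - 1) n) (x :: 'b::field_char_0) = pochhammer x n"
proof -
  have "poly (falling_factorial (monom 1 1 + of_nat n - 1) n) x = (\<Prod>i<n. x + of_nat n - 1 - of_nat i)"
    unfolding falling_factorial_def poly_prod by (simp add: poly_monom)
  also have "\<dots> = (\<Prod>i<n. x + of_nat (n - Suc i))"
    by (rule prod.cong) (auto simp: of_nat_diff)
  also have "\<dots> = (\<Prod>i<n. x + of_nat i)" by (rule prod.nat_diff_reindex)
  finally show ?thesis by (simp add: pochhammer_prod lessThan_atLeast0)
qed

text \<open>Multiplying both polynomials by the variable forces agreement at \<open>0\<close> as
  well. This recovers the value lost by cancelling \<open>q\<close>.\<close>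

lemma poly_eqI_nonzero:
  fixes p r :: "'b::field_char_0 poly"
  assumes "\<And>x. x \<noteq> 0 \<Longrightarrow> poly p x = poly r x"
  shows "p = r"
proof -
  have "poly (pCons 0 p) = poly (pCons 0 r)" using assms by (auto simp: fun_eq_iff)
  then show ?thesis unfolding poly_eq_poly_eq_iff by simp
qed

theorem theorem3:
  fixes n :: nat and lam :: "nat multiset"
  assumes "n \<ge> 1" and "partition_of lam n"
  shows "(cycle_poly n lam :: 'a::field_char_0 poly) =
    smult (inverse (of_nat (z_partition lam)))
      (poly_op (g_poly lam) backward_shift
        (falling_factorial (monom 1 1 + of_nat n - 1) n))"
proof (rule poly_eqI_nonzero)
  fix q :: 'a assume q: "q \<noteq> 0"
  have lam: "0 \<notin># lam" "sum_mset lam = card {1..n}"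
    using assms(2) by (simp_all add: partition_of_def)
  have z: "of_nat (z_partition lam) \<noteq> (0 :: 'a)" using z_partition_pos[OF lam(1)] by simp
  have type: "cycle_type n w = cycle_type_on {1..n} w" for w
    by (simp add: cycle_type_def cycle_type_on_def perm_cycles_def)
  have "poly (cycle_poly n lam) q =
    (\<Sum>w | w permutes {1..n} \<and> cycle_type_on {1..n} w = lam. q ^ card (cycles_on (long_cycle n \<circ> w) {1..n}))"
    by (simp add: cycle_poly_def poly_sum poly_monom type num_cycles_def perm_cycles_def)
  \<comment> \<open>The \<open>k\<close>-th power of the shift moves the argument to
    \<open>q - k\<close>, so evaluating the operator at \<open>q\<close> yields the functional
    \<open>coeff_sum\<close>.\<close>
  moreover have "poly (poly_op (g_poly lam) backward_shift (falling_factorial (monom 1 1 + of_nat n - 1) n)) q =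
    coeff_sum (\<lambda>k. pochhammer (q - of_nat k) (card {1..n})) (g_poly lam)"
    unfolding poly_op_def poly_sum poly_smult poly_backward_shift_funpow poly_falling_factorial coeff_sum_def
    by simp
  moreover have "of_nat (z_partition lam) * (\<Sum>w | w permutes {1..n} \<and> cycle_type_on {1..n} w = lam. q ^ card (cycles_on (long_cycle n \<circ> w) {1..n})) =
    coeff_sum (\<lambda>k. pochhammer (q - of_nat k) (card {1..n})) (g_poly lam)"
    by (rule sum_cycle_type_full_cycle[OF _ _ long_cycle_permutes cycles_on_long_cycle[OF assms(1)] lam q])
       (use assms(1) in auto)
  ultimately show "poly (cycle_poly n lam) q = poly (smult (inverse (of_nat (z_partition lam)))
      (poly_op (g_poly lam) backward_shift (falling_factorial (monom 1 1 + of_nat n - 1) n))) q"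
    using z by (simp add: field_simps)
qed

end
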